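(* Let $1<p<\infty$, let $q$ satisfy $pq=p+q$, and let $\Omega=\{(u,v)\in\mathbb{R}^2:|u|^p+|v|^p\le1\}$. Then $\cos_\Omega\theta=\cos_p\theta$ and $\sin_\Omega\theta=\sin_p\theta$ for all $\theta\in\mathbb{R}$. The polar set $\Omega^\circ$ is $\{(u,v):|u|^q+|v|^q\le1\}$; for each $\theta$ the angle $\theta^\circ$ with $\theta\xleftrightarrow{\Omega}\theta^\circ$ is unique modulo $2\mathbb{S}_q$ and is given by the unique solution of $\varphi_q(\theta^\circ)=\varphi_p(\theta)$; and $\cos_{\Omega^\circ}\theta^\circ=\cos_q\theta^\circ$, $\sin_{\Omega^\circ}\theta^\circ=\sin_q\theta^\circ$. In particular the area of $\Omega$ equals $\mathbb{S}_p=\dfrac{4\Gamma^2(1+\frac1p)}{\Gamma(1+\frac2p)}$.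
   Context: Convex trigonometry: for compact convex $\Omega\subset\mathbb{R}^2$ with $0\in\operatorname{int}\Omega$ and area $\mathbb{S}$, and $\theta\in[0,2\mathbb{S})$, let $P_\theta\in\partial\Omega$ be the point such that the area of the sector of $\Omega$ swept counterclockwise from the positive $x$-axis to the ray $OP_\theta$ equals $\theta/2$; $(\cos_\Omega\theta,\sin_\Omega\theta)$ are the coordinates of $P_\theta$, extended $2\mathbb{S}$-periodically. $\Omega^\circ=\{(p,q):pu+qv\le1\ \forall(u,v)\in\Omega\}$ is the polar set, with $\cos_{\Omega^\circ},\sin_{\Omega^\circ}$ defined likewise; $\theta\xleftrightarrow{\Omega}\theta^\circ$ means $\cos_\Omega\theta\cos_{\Omega^\circ}\theta^\circ+\sin_\Omega\theta\sin_{\Omega^\circ}\theta^\circ=1$. Generalized $L_p$ trigonometric functions: let $B(x;a,b)=\int_0^xt^{a-1}(1-t)^{b-1}dt$ be the incomplete Euler beta integral, $\mathbb{S}_p=4\Gamma^2(1+\frac1p)/\Gamma(1+\frac2p)$, and for $\varphi\in\mathbb{R}$ with $k=\lfloor4\varphi/\pi\rfloor$ put \[ \Theta_p(\varphi)=\frac{k-\lfloor k/2\rfloor}{2}\,\mathbb{S}_p+(-1)^k\,\tfrac1p4^{-1/p}\,B\big(\sin^22\varphi;\tfrac1p,\tfrac12\big). \] $\Theta_p$ is a strictly increasing bijection $\mathbb{R}\to\mathbb{R}$; let $\varphi_p=\Theta_p^{-1}$ and define $\cos_p\theta=|\cos\varphi_p(\theta)|^{2/p}\operatorname{sgn}\cos\varphi_p(\theta)$,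 $\sin_p\theta=|\sin\varphi_p(\theta)|^{2/p}\operatorname{sgn}\sin\varphi_p(\theta)$. The objects $\mathbb{S}_q,\varphi_q,\cos_q,\sin_q$ are defined by the same formulas with $p$ replaced by $q$. *)

theory Defs
  imports "HOL-Analysis.Analysis"
begin

definition area :: "(real \<times> real) set \<Rightarrow> real" where
  "area A = measure lebesgue A"

definition sector :: "(real \<times> real) set \<Rightarrow> real \<Rightarrow> (real \<times> real) set" where
  "sector \<Omega> \<alpha> = {z \<in> \<Omega>. \<exists>r\<ge>0. \<exists>t\<in>{0..\<alpha>}. z = (r * cos t, r * sin t)}"

text \<open>For theta in [0, 2 area), the polar angle of the ray O P_theta.\<close>
definition cvx_angle :: "(real \<times> real) set \<Rightarrow> real \<Rightarrow> real" where
  "cvx_angle \<Omega> \<theta> = (THE \<alpha>. \<alpha> \<in> {0..<2*pi} \<and> area (sector \<Omega> \<alpha>) = \<theta> / 2)"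

definition ray_bpoint :: "(real \<times> real) set \<Rightarrow> real \<Rightarrow> real \<times> real" where
  "ray_bpoint \<Omega> \<alpha> = (THE z. z \<in> frontier \<Omega> \<and> (\<exists>r>0. z = (r * cos \<alpha>, r * sin \<alpha>)))"

definition cvx_point :: "(real \<times> real) set \<Rightarrow> real \<Rightarrow> real \<times> real" where
  "cvx_point \<Omega> \<theta> =
     (let S = area \<Omega>; \<theta>0 = \<theta> - 2 * S * of_int \<lfloor>\<theta> / (2 * S)\<rfloor>
      in ray_bpoint \<Omega> (cvx_angle \<Omega> \<theta>0))"

definition cos_cvx :: "(real \<times> real) set \<Rightarrow> real \<Rightarrow> real" where
  "cos_cvx \<Omega> \<theta> = fst (cvx_point \<Omega> \<theta>)"

definition sin_cvx :: "(real \<times> real) set \<Rightarrow> real \<Rightarrow> real" where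
  "sin_cvx \<Omega> \<theta> = snd (cvx_point \<Omega> \<theta>)"

definition polar_set :: "(real \<times> real) set \<Rightarrow> (real \<times> real) set" where
  "polar_set \<Omega> = {(p, q). \<forall>(u, v) \<in> \<Omega>. p * u + q * v \<le> 1}"

definition cvx_corr :: "(real \<times> real) set \<Rightarrow> real \<Rightarrow> real \<Rightarrow> bool" where
  "cvx_corr \<Omega> \<theta> \<theta>' \<longleftrightarrow>
     cos_cvx \<Omega> \<theta> * cos_cvx (polar_set \<Omega>) \<theta>' + sin_cvx \<Omega> \<theta> * sin_cvx (polar_set \<Omega>) \<theta>' = 1"

definition inc_beta :: "real \<Rightarrow> real \<Rightarrow> real \<Rightarrow> real" where
  "inc_beta x a b = integral {0..x} (\<lambda>t. t powr (a - 1) * (1 - t) powr (b - 1))"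

definition Sp :: "real \<Rightarrow> real" where
  "Sp p = 4 * (Gamma (1 + 1/p))\<^sup>2 / Gamma (1 + 2/p)"

definition Theta_p :: "real \<Rightarrow> real \<Rightarrow> real" where
  "Theta_p p \<phi> =
     (let k = \<lfloor>4 * \<phi> / pi\<rfloor>
      in real_of_int (k - \<lfloor>real_of_int k / 2\<rfloor>) / 2 * Sp p
         + (-1) powi k * (1 / p) * 4 powr (- 1 / p) * inc_beta ((sin (2 * \<phi>))\<^sup>2) (1 / p) (1 / 2))"

definition phi_p :: "real \<Rightarrow> real \<Rightarrow> real" where
  "phi_p p = inv (Theta_p p)"

definition cos_p :: "real \<Rightarrow> real \<Rightarrow> real" where
  "cos_p p \<theta> = \<bar>cos (phi_p p \<theta>)\<bar> powr (2 / p) * sgn (cos (phi_p p \<theta>))"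

definition sin_p :: "real \<Rightarrow> real \<Rightarrow> real" where
  "sin_p p \<theta> = \<bar>sin (phi_p p \<theta>)\<bar> powr (2 / p) * sgn (sin (phi_p p \<theta>))"

end

theory Submission
  imports Defs
begin

text \<open>The curve \<open>\<phi> \<mapsto> (cos \<phi>, sin \<phi>)\<close> with both coordinates raised to the signed power \<open>2/p\<close>
  parametrises the boundary of \<open>\<Omega>\<close>. In the first quadrant, twice the area of the sector swept up to
  parameter \<open>\<phi>\<close> has derivative \<open>x y' - x' y = (2/p) (cos \<phi> sin \<phi>) powr (2/p - 1)\<close>, which is also the
  derivative of \<open>\<Theta>\<^sub>p\<close>; the two branches of \<open>\<Theta>\<^sub>p\<close> fit together at \<open>\<pi>/4\<close> by Legendre's duplication
  formula. The other quadrants follow by rotation through a right angle. Duality is the inequality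
  \<open>X powr (1/p) * Y powr (1/q) \<le> X/p + Y/q\<close>, applied to the squared cosines and to the squared sines of
  the two parameters; equality forces \<open>X = Y\<close>, so polar points have the same parameter modulo \<open>2\<pi>\<close>.\<close>

section \<open>Signed powers and the parametrised curve\<close>

text \<open>Convex trigonometry locates a boundary point by the polar angle of its ray, whereas
  \<open>Theta_p\<close> is a function of the curve parameter, which for p other than 2 agrees with
  the polar angle only at multiples of pi/4. Both definite descriptions must therefore be evaluated
  by passing between angle and parameter.

  Two singularities prevent a plain differentiation argument: for p > 2 the common derivative blows
  up at the axes, and the beta integrand blows up at pi/4, where sin^2 (2*\<phi>) reaches 1.
  Derivatives are compared on open octants only, and continuity joins them.

  The shape of \<open>Theta_p\<close>: in each quadrant t = sin^2 (2*\<phi>) runs from 0 to 1 and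
  back, so the beta integral is folded. The sign (-1)^k unfolds it, k - floor (k/2) = ceiling (k/2)
  counts the summands Sp/2 to be added, and 4 powr (-1/p) comes from cos \<phi> * sin \<phi> = sin
  (2*\<phi>) / 2.\<close>

definition spow :: "real \<Rightarrow> real \<Rightarrow> real" where
  "spow a x = \<bar>x\<bar> powr a * sgn x"

lemma abs_spow: "\<bar>spow a x\<bar> = \<bar>x\<bar> powr a"
  by (auto simp: spow_def abs_mult)

lemma spow_minus [simp]: "spow a (- x) = - spow a x"
  by (simp add: spow_def sgn_minus)

lemma spow_nonneg: "x \<ge> 0 \<Longrightarrow> spow a x = x powr a"
  by (auto simp: spow_def sgn_if)

text \<open>Exponents multiply because the sign is kept separately, so \<open>spow (1 / a)\<close>
  undoes \<open>spow a\<close> for nonzero a. Injectivity of the curve and the recovery of a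
  parameter from a point rest on this.\<close>

lemma spow_spow: "spow a (spow b x) = spow (b * a) x"
  unfolding spow_def[of a] abs_spow by (auto simp: spow_def sgn_mult powr_powr)

lemma spow_one [simp]: "spow 1 x = x"
  by (simp add: spow_def abs_mult_sgn)

lemma spow_inject: "a \<noteq> 0 \<Longrightarrow> spow a x = spow a y \<longleftrightarrow> x = y"
  by (metis spow_spow spow_one right_inverse)

definition lp_point :: "real \<Rightarrow> real \<Rightarrow> real \<times> real" where
  "lp_point p \<phi> = (spow (2 / p) (cos \<phi>), spow (2 / p) (sin \<phi>))"

definition lp_gauge :: "real \<Rightarrow> real \<times> real \<Rightarrow> real" where
  "lp_gauge p z = \<bar>fst z\<bar> powr p + \<bar>snd z\<bar> powr p"

definition lp_ball :: "real \<Rightarrow> (real \<times> real) set" where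
  "lp_ball p = {z. lp_gauge p z \<le> 1}"

lemma lp_gauge_pos: "z \<noteq> 0 \<Longrightarrow> lp_gauge p z > 0"
  by (cases z) (auto simp: lp_gauge_def zero_prod_def add_pos_nonneg add_nonneg_pos)

lemma lp_gauge_scale: "r \<ge> 0 \<Longrightarrow> lp_gauge p (r *\<^sub>R z) = r powr p * lp_gauge p z"
  by (simp add: lp_gauge_def abs_mult powr_mult ring_distribs)

lemma powr_le_1_iff: "0 \<le> (r::real) \<Longrightarrow> 0 < a \<Longrightarrow> r powr a \<le> 1 \<longleftrightarrow> r \<le> 1"
  using powr_mono2[of a r 1] powr_less_mono2[of a 1 r]
  unfolding powr_one_eq_one by linarith

lemma square_powr: "((x::real)\<^sup>2) powr a = \<bar>x\<bar> powr (2 * a)"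
proof -
  have "x\<^sup>2 = \<bar>x\<bar> powr 2" by simp
  then show ?thesis by (simp only: powr_powr)
qed

lemma abs_spow_two_powr: "p > 0 \<Longrightarrow> \<bar>spow (2 / p) x\<bar> powr p = x\<^sup>2"
  by (cases "x = 0") (auto simp: abs_spow powr_powr)

lemma lp_gauge_lp_point: "p > 0 \<Longrightarrow> lp_gauge p (lp_point p \<phi>) = 1"
  by (simp add: lp_gauge_def lp_point_def abs_spow_two_powr)

lemma sin_cos_eq_imp:
  assumes "cos x = cos y" "sin x = sin (y::real)"
  obtains k :: int where "x = y + 2 * pi * of_int k"
proof -
  have "cos (x - y) = 1"
    using assms sin_cos_squared_add3[of y] by (simp add: cos_diff)
  then obtain k :: int where "x - y = of_int k * 2 * pi"
    by (auto simp: cos_one_2pi_int)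
  then show ?thesis by (intro that[of k]) (simp add: algebra_simps)
qed

lemma lp_point_eq_imp:
  assumes "p > 0" "lp_point p x = lp_point p y"
  obtains k :: int where "x = y + 2 * pi * of_int k"
  using assms sin_cos_eq_imp[of x y] by (auto simp: lp_point_def spow_inject)

lemma lp_point_periodic: "lp_point p (x + 2 * pi * of_int k) = lp_point p x"
  using cos.plus_of_int[of x k] sin.plus_of_int[of x k] by (simp add: lp_point_def mult_ac)

text \<open>Signed powers with exponent p/2 carry the level curve to the Euclidean unit circle,
  where the ordinary angle serves as parameter.\<close>

lemma lp_gauge_eq_1_imp:
  assumes "p > 0" "lp_gauge p z = 1"
  obtains \<phi> where "0 \<le> \<phi>" "\<phi> < 2 * pi" "z = lp_point p \<phi>"
proof -
  define x y where "x = spow (p / 2) (fst z)" and "y = spow (p / 2) (snd z)"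
  have z: "fst z = spow (2 / p) x" "snd z = spow (2 / p) y"
    using assms by (auto simp: x_def y_def spow_spow)
  have "x\<^sup>2 + y\<^sup>2 = 1"
    using assms by (simp add: lp_gauge_def z abs_spow_two_powr)
  then obtain t where "0 \<le> t" "t < 2 * pi" "x = cos t" "y = sin t"
    using sincos_total_2pi by metis
  with z show ?thesis by (intro that[of t]) (auto simp: lp_point_def prod_eq_iff)
qed

text \<open>Polar coordinates adapted to the ball: r is the p-th root of the gauge, and \<phi> is
  the curve parameter, not the Euclidean angle.\<close>

lemma polar_decomposition_lp:
  assumes "p > 0" "z \<noteq> 0"
  obtains r \<phi> where "r > 0" "0 \<le> \<phi>" "\<phi> < 2 * pi" "z = r *\<^sub>R lp_point p \<phi>" "lp_gauge p z = r powr p"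
proof -
  define r where "r = lp_gauge p z powr (1 / p)"
  have g: "lp_gauge p z > 0" using assms lp_gauge_pos by blast
  then have r: "r > 0" "r powr p = lp_gauge p z"
    using assms by (auto simp: r_def powr_powr)
  have "lp_gauge p ((1 / r) *\<^sub>R z) = 1"
    using r g assms by (simp add: lp_gauge_scale powr_divide)
  then obtain \<phi> where "0 \<le> \<phi>" "\<phi> < 2 * pi" "(1 / r) *\<^sub>R z = lp_point p \<phi>"
    using lp_gauge_eq_1_imp assms by blast
  then show ?thesis using r by (intro that[of r \<phi>]) (auto dest: sym)
qed

section \<open>Duality\<close>

text \<open>The concave power lies below its tangent at 1. This is weighted AM-GM for t and 1; the
  equality case is what later makes the corresponding angle unique.\<close>

lemma powr_le_tangent:
  assumes "0 < a" "a < 1" "0 < (t::real)"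
  shows "t powr a \<le> 1 + a * (t - 1)" "t powr a = 1 + a * (t - 1) \<Longrightarrow> t = 1"
proof -
  have conc: "t powr a \<le> 1 + a * (t - 1) \<and> (t powr a = 1 + a * (t - 1) \<longrightarrow> t = 1)"
  proof -
    \<comment> \<open>\<open>L\<close> is also the weighted mean a*t + (1 - a). Dividing by it makes
      the upper bounds from ln x \<le> x - 1 at t/L and 1/L cancel under the weights a and 1 -
      a.\<close>
    define L where "L = 1 + a * (t - 1)"
    have L: "L > 0"
    proof -
      have "L = (1 - a) + a * t" by (simp add: L_def algebra_simps)
      then show ?thesis using assms by (simp add: add_pos_pos)
    qed
    have "a * ln (t / L) + (1 - a) * ln (1 / L) \<le> a * (t / L - 1) + (1 - a) * (1 / L - 1)"
      using assms L by (intro add_mono mult_left_mono ln_le_minus_one) auto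
    also have "\<dots> = 0" using L by (simp add: field_simps) (simp add: L_def algebra_simps)
    finally have 1: "a * ln (t / L) + (1 - a) * ln (1 / L) \<le> 0" .
    have 2: "a * ln (t / L) + (1 - a) * ln (1 / L) = a * ln t - ln L"
      using assms L by (simp add: ln_div algebra_simps)
    have le: "t powr a \<le> L"
      using 1 2 L assms by (simp add: powr_def ln_ge_iff[symmetric])
    moreover have "t = 1" if "t powr a = L"
    proof -
      have "a * ln t = ln L" using that assms by (metis ln_powr)
      with 2 have "a * ln (t / L) + (1 - a) * ln (1 / L) = 0" by simp
      moreover have "a * ln (t / L) \<le> a * (t / L - 1)" "(1 - a) * ln (1 / L) \<le> (1 - a) * (1 / L - 1)"
        using assms L by (intro mult_left_mono ln_le_minus_one; simp)+
      moreover have "a * (t / L - 1) + (1 - a) * (1 / L - 1) = 0"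
        using L by (simp add: field_simps) (simp add: L_def algebra_simps)
      \<comment> \<open>Two termwise inequalities with equal sums are both equalities; the one at
        1/L gives L = 1.\<close>
      ultimately have "(1 - a) * ln (1 / L) = (1 - a) * (1 / L - 1)" by linarith
      then have "1 / L = 1" using assms L by (intro ln_eq_minus_one) auto
      then show "t = 1" using assms by (simp add: L_def)
    qed
    ultimately show ?thesis by (simp add: L_def)
  qed
  then show "t powr a \<le> 1 + a * (t - 1)" "t powr a = 1 + a * (t - 1) \<Longrightarrow> t = 1" by auto
qed

text \<open>For nonzero arguments of equal sign, factoring out y^2 leaves the tangent bound for t =
  x^2/y^2 with exponent 1/p. Otherwise the left side is at most 0, while the right side is
  nonnegative and vanishes only for x = y = 0.\<close>

lemma young_spow:
  fixes x y :: real
  assumes "1 < p" "1 < q" "1 / p + 1 / q = 1"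
  shows "spow (2 / p) x * spow (2 / q) y \<le> x\<^sup>2 / p + y\<^sup>2 / q"
    and "spow (2 / p) x * spow (2 / q) y = x\<^sup>2 / p + y\<^sup>2 / q \<longleftrightarrow> x = y"
proof -
  have conc: "spow (2 / p) x * spow (2 / q) y \<le> x\<^sup>2 / p + y\<^sup>2 / q \<and>
    (spow (2 / p) x * spow (2 / q) y = x\<^sup>2 / p + y\<^sup>2 / q \<longleftrightarrow> x = y)"
  proof (cases "x = 0 \<or> y = 0 \<or> sgn x \<noteq> sgn y")
    case True
    then have "spow (2 / p) x * spow (2 / q) y \<le> 0"
      by (auto simp: spow_def sgn_if mult_nonneg_nonpos split: if_splits)
    moreover have "x\<^sup>2 / p + y\<^sup>2 / q \<ge> 0" "x\<^sup>2 / p + y\<^sup>2 / q = 0 \<Longrightarrow> x = 0 \<and> y = 0"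
      using assms by (auto simp: add_nonneg_eq_0_iff)
    ultimately show ?thesis using True by (auto simp: spow_def)
  next
    case False
    then have nz: "x \<noteq> 0" "y \<noteq> 0" "sgn x = sgn y" by auto
    have xy: "x = y \<longleftrightarrow> \<bar>x\<bar> = \<bar>y\<bar>" using nz by (auto simp: sgn_if split: if_splits)
    define t where "t = x\<^sup>2 / y\<^sup>2"
    have t: "t > 0" using nz by (simp add: t_def)
    have q: "1 / q = 1 - 1 / p" "2 / q = 2 - 2 / p" using assms by (auto simp: field_simps)
    have "spow (2 / p) x * spow (2 / q) y = \<bar>x\<bar> powr (2 / p) * \<bar>y\<bar> powr (2 / q)"
      using nz by (simp add: spow_def sgn_if split: if_splits)
    also have "\<dots> = y\<^sup>2 * (\<bar>x\<bar> powr (2 / p) / \<bar>y\<bar> powr (2 / p))"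
      using nz unfolding q(2) powr_diff by simp
    also have "\<bar>x\<bar> powr (2 / p) / \<bar>y\<bar> powr (2 / p) = t powr (1 / p)"
      using nz by (simp add: t_def powr_divide square_powr)
    finally have 1: "spow (2 / p) x * spow (2 / q) y = y\<^sup>2 * t powr (1 / p)" .
    have "x\<^sup>2 / p + y\<^sup>2 / q = x\<^sup>2 * (1 / p) + y\<^sup>2 * (1 / q)" by simp
    also have "\<dots> = y\<^sup>2 * (1 + (1 / p) * (t - 1))"
      unfolding q(1) t_def using nz by (simp add: divide_simps) (simp add: algebra_simps power2_eq_square)
    finally have 2: "x\<^sup>2 / p + y\<^sup>2 / q = y\<^sup>2 * (1 + (1 / p) * (t - 1))" .
    have "t = 1 \<longleftrightarrow> \<bar>x\<bar> = \<bar>y\<bar>" using nz by (auto simp: t_def abs_eq_iff power2_eq_iff)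
    moreover have "t powr (1 / p) \<le> 1 + (1 / p) * (t - 1)"
      "t powr (1 / p) = 1 + (1 / p) * (t - 1) \<longleftrightarrow> t = 1"
      using powr_le_tangent[of "1 / p" t] t assms by auto
    ultimately show ?thesis unfolding 1 2 xy using nz
      by (simp add: mult_le_cancel_left)
  qed
  then show "spow (2 / p) x * spow (2 / q) y \<le> x\<^sup>2 / p + y\<^sup>2 / q"
    "spow (2 / p) x * spow (2 / q) y = x\<^sup>2 / p + y\<^sup>2 / q \<longleftrightarrow> x = y" by auto
qed

text \<open>The two right-hand sides of \<open>young_spow\<close> add up to 1/p + 1/q = 1, so inner
  product 1 forces equality in both. That equality retains signs, which pins the parameter modulo
  2*pi and not merely up to reflections.\<close>

lemma lp_point_inner:
  assumes "1 < p" "1 < q" "1 / p + 1 / q = 1"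
  shows "lp_point p x \<bullet> lp_point q y \<le> 1"
    and "lp_point p x \<bullet> lp_point q y = 1 \<longleftrightarrow> (\<exists>k::int. y = x + 2 * pi * of_int k)"
proof -
  have 1: "(cos x)\<^sup>2 / p + (cos y)\<^sup>2 / q + ((sin x)\<^sup>2 / p + (sin y)\<^sup>2 / q) = 1"
  proof -
    have "(cos x)\<^sup>2 / p + (cos y)\<^sup>2 / q + ((sin x)\<^sup>2 / p + (sin y)\<^sup>2 / q)
      = ((cos x)\<^sup>2 + (sin x)\<^sup>2) / p + ((cos y)\<^sup>2 + (sin y)\<^sup>2) / q"
      unfolding add_divide_distrib by simp
    also have "\<dots> = 1" using assms by (simp only: sin_cos_squared_add2)
    finally show ?thesis .
  qed
  note y = young_spow[OF assms, of "cos x" "cos y"] young_spow[OF assms, of "sin x" "sin y"]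
  show "lp_point p x \<bullet> lp_point q y \<le> 1"
    using 1 y(1,3) by (simp add: lp_point_def inner_prod_def)
  have "lp_point p x \<bullet> lp_point q y = 1 \<longleftrightarrow> cos x = cos y \<and> sin x = sin y"
    unfolding y(2,4)[symmetric] using 1 y(1,3) by (auto simp: lp_point_def inner_prod_def)
  also have "\<dots> \<longleftrightarrow> (\<exists>k::int. y = x + 2 * pi * of_int k)"
  proof
    assume "cos x = cos y \<and> sin x = sin y"
    then show "\<exists>k::int. y = x + 2 * pi * of_int k"
      using sin_cos_eq_imp[of y x] by metis
  next
    assume "\<exists>k::int. y = x + 2 * pi * of_int k"
    then show "cos x = cos y \<and> sin x = sin y"
      using cos.plus_of_int[of x] sin.plus_of_int[of x] by (auto simp: mult_ac)
  qed
  finally show "lp_point p x \<bullet> lp_point q y = 1 \<longleftrightarrow> (\<exists>k::int. y = x + 2 * pi * of_int k)" .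
qed

text \<open>With z = r times \<open>lp_point q \<phi>\<close>, both memberships say r \<le> 1.
  Testing against \<open>lp_point p \<phi>\<close>, where the inner product is exactly r, gives
  necessity; scaling the bound of \<open>lp_point_inner\<close> gives sufficiency.\<close>

lemma polar_set_lp_ball:
  assumes "1 < p" "1 < q" "1 / p + 1 / q = 1"
  shows "polar_set (lp_ball p) = lp_ball q"
proof -
  have polar: "z \<in> polar_set (lp_ball p) \<longleftrightarrow> (\<forall>w\<in>lp_ball p. w \<bullet> z \<le> 1)" for z
    by (auto simp: polar_set_def inner_prod_def mult.commute)
  have "z \<in> polar_set (lp_ball p) \<longleftrightarrow> z \<in> lp_ball q" for z
  proof (cases "z = 0")
    case True
    then show ?thesis unfolding polar by (simp add: lp_ball_def lp_gauge_def)
  next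
    case False
    then obtain r \<phi> where z: "r > 0" "z = r *\<^sub>R lp_point q \<phi>" "lp_gauge q z = r powr q"
      using polar_decomposition_lp[of q z] assms by (metis less_trans zero_less_one)
    have "z \<in> polar_set (lp_ball p) \<longleftrightarrow> r \<le> 1"
    proof
      assume "z \<in> polar_set (lp_ball p)"
      moreover have "lp_point p \<phi> \<in> lp_ball p"
        using assms by (simp add: lp_ball_def lp_gauge_lp_point)
      ultimately have "lp_point p \<phi> \<bullet> z \<le> 1" unfolding polar by blast
      moreover have "lp_point p \<phi> \<bullet> lp_point q \<phi> = 1"
        by (subst lp_point_inner(2)[OF assms]) (auto intro: exI[of _ 0])
      ultimately show "r \<le> 1" by (simp add: z)
    next
      assume r: "r \<le> 1"
      show "z \<in> polar_set (lp_ball p)" unfolding polar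
      proof
        fix w assume w: "w \<in> lp_ball p"
        show "w \<bullet> z \<le> 1"
        proof (cases "w = 0")
          case False
          then obtain s \<psi> where s: "s > 0" "w = s *\<^sub>R lp_point p \<psi>" "lp_gauge p w = s powr p"
            using polar_decomposition_lp[of p w] assms by (metis less_trans zero_less_one)
          have "s \<le> 1" using w s assms by (simp add: lp_ball_def powr_le_1_iff)
          have "w \<bullet> z = (s * r) * (lp_point p \<psi> \<bullet> lp_point q \<phi>)" by (simp add: s z)
          also have "\<dots> \<le> (s * r) * 1"
            using s z by (intro mult_left_mono lp_point_inner assms) auto
          also have "\<dots> \<le> 1" using s z r \<open>s \<le> 1\<close> by (simp add: mult_le_one)
          finally show ?thesis .
        qed simp
      qed
    qed
    also have "\<dots> \<longleftrightarrow> r powr q \<le> 1"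
      using z(1) assms by (simp add: powr_le_1_iff)
    finally show ?thesis using z by (simp add: lp_ball_def)
  qed
  then show ?thesis by blast
qed

section \<open>Sectors and their areas\<close>

text \<open>The initial angle is free because a rotated sector no longer starts at the positive
  x-axis.\<close>

definition wedge :: "(real \<times> real) set \<Rightarrow> real \<Rightarrow> real \<Rightarrow> (real \<times> real) set" where
  "wedge \<Omega> a b = {z \<in> \<Omega>. \<exists>r\<ge>0. \<exists>t\<in>{a..b}. z = (r * cos t, r * sin t)}"

lemma sector_eq_wedge: "sector \<Omega> \<alpha> = wedge \<Omega> 0 \<alpha>"
  by (simp add: sector_def wedge_def)

definition rot :: "real \<times> real \<Rightarrow> real \<times> real" where
  "rot z = (- snd z, fst z)"

lemma norm_polar: "r \<ge> 0 \<Longrightarrow> norm (r * cos t, r * sin t) = (r::real)"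
  by (simp add: norm_Pair power_mult_distrib flip: distrib_left)

text \<open>The wedge is \<Omega> intersected with the continuous image of a rectangle of polar
  coordinates. Compactness supplies measurability and finite area.\<close>

lemma compact_wedge:
  assumes "compact \<Omega>"
  shows "compact (wedge \<Omega> a b)"
proof -
  obtain B where B: "\<And>z. z \<in> \<Omega> \<Longrightarrow> norm z \<le> B"
    using compact_imp_bounded[OF assms] bounded_iff by blast
  define f :: "real \<times> real \<Rightarrow> real \<times> real" where "f = (\<lambda>(r, t). (r * cos t, r * sin t))"
  have "wedge \<Omega> a b = \<Omega> \<inter> f ` ({0..B} \<times> {a..b})"
  proof (intro equalityI subsetI)
    fix z assume "z \<in> wedge \<Omega> a b"
    then obtain r t where z: "z \<in> \<Omega>" "r \<ge> 0" "t \<in> {a..b}" "z = (r * cos t, r * sin t)"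
      by (auto simp: wedge_def)
    with B[of z] have "(r, t) \<in> {0..B} \<times> {a..b}" by (simp add: norm_polar)
    then show "z \<in> \<Omega> \<inter> f ` ({0..B} \<times> {a..b})"
      using z by (auto simp: f_def intro!: image_eqI[of _ _ "(r, t)"])
  qed (auto simp: wedge_def f_def)
  moreover have "compact (f ` ({0..B} \<times> {a..b}))"
    unfolding f_def case_prod_beta
    by (intro compact_continuous_image compact_Times continuous_intros) auto
  ultimately show ?thesis using assms by (simp add: compact_Int)
qed

section \<open>Areas by slicing: rotation invariance and additivity of wedges\<close>

lemma emeasure_lborel_prod:
  fixes X :: "(real \<times> real) set"
  assumes "X \<in> sets borel"
  shows "emeasure lborel X = (\<integral>\<^sup>+x. emeasure lborel (Pair x -` X) \<partial>lborel)"
    and "emeasure lborel X = (\<integral>\<^sup>+y. emeasure lborel ((\<lambda>x. (x, y)) -` X) \<partial>lborel)"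
proof -
  have X: "X \<in> sets (lborel \<Otimes>\<^sub>M lborel)" using assms unfolding lborel_prod by simp
  show "emeasure lborel X = (\<integral>\<^sup>+x. emeasure lborel (Pair x -` X) \<partial>lborel)"
    using lborel.emeasure_pair_measure_alt[OF X] by (simp add: lborel_prod)
  show "emeasure lborel X = (\<integral>\<^sup>+y. emeasure lborel ((\<lambda>x. (x, y)) -` X) \<partial>lborel)"
    using lborel_pair.emeasure_pair_measure_alt2[OF X] by (simp add: lborel_prod)
qed

lemma area_compact: "compact X \<Longrightarrow> area X = measure lborel X"
  unfolding area_def by (intro measure_completion) (auto dest: compact_imp_closed)

text \<open>The vertical slice of the rotated set at x is the horizontal slice of the original at
  height -x. Integrating slices in the two orders and reflecting x gives the equality.\<close>

lemma area_rot:
  assumes "compact X"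
  shows "area (rot ` X) = area X"
proof -
  have c: "compact (rot ` X)"
    unfolding rot_def using assms by (intro compact_continuous_image continuous_intros)
  have X[measurable]: "X \<in> sets borel" and rX: "rot ` X \<in> sets borel"
    using assms c by (auto intro: borel_compact)
  have slice: "Pair x -` (rot ` X) = (\<lambda>y. (y, - x)) -` X" for x
  proof (intro equalityI subsetI)
    fix y assume "y \<in> (\<lambda>y. (y, - x)) -` X"
    moreover have "(x, y) = rot (y, - x)" by (simp add: rot_def)
    ultimately show "y \<in> Pair x -` (rot ` X)" by (metis imageI vimageE vimageI)
  qed (auto simp: rot_def)
  have meas: "(\<lambda>y. emeasure lborel ((\<lambda>x. (x, y)) -` X)) \<in> borel_measurable (borel :: real measure)"
  proof -
    have "X \<in> sets (lborel \<Otimes>\<^sub>M lborel)" using X unfolding lborel_prod by simp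
    from lborel_pair.measurable_emeasure_Pair2[OF this] show ?thesis by simp
  qed
  have "emeasure lborel (rot ` X) = (\<integral>\<^sup>+x. emeasure lborel ((\<lambda>y. (y, - x)) -` X) \<partial>lborel)"
    unfolding emeasure_lborel_prod(1)[OF rX] slice ..
  also have "\<dots> = (\<integral>\<^sup>+x. emeasure lborel ((\<lambda>y. (y, x)) -` X) \<partial>lborel)"
    using nn_integral_real_affine[OF meas, of "-1" 0] by simp
  also have "\<dots> = emeasure lborel X"
    using emeasure_lborel_prod(2)[OF X] by simp
  finally show ?thesis
    using assms c by (simp add: area_compact measure_def)
qed

lemma rot_wedge:
  assumes "rot ` \<Omega> = \<Omega>"
  shows "rot ` wedge \<Omega> a b = wedge \<Omega> (a + pi / 2) (b + pi / 2)"
proof -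
  have inj: "rot z = rot w \<longleftrightarrow> z = w" for z w by (auto simp: rot_def prod_eq_iff)
  have rot_polar: "rot (r * cos t, r * sin t) = (r * cos (t + pi / 2), r * sin (t + pi / 2))" for r t
    by (simp add: rot_def cos_add sin_add)
  have mem: "rot z \<in> \<Omega> \<longleftrightarrow> z \<in> \<Omega>" for z
    using assms inj by (metis imageE imageI)
  show ?thesis
  proof (intro equalityI subsetI)
    fix z assume "z \<in> rot ` wedge \<Omega> a b"
    then obtain r t where z: "(r * cos t, r * sin t) \<in> \<Omega>" "r \<ge> 0" "t \<in> {a..b}"
      "z = rot (r * cos t, r * sin t)" by (auto simp: wedge_def)
    then have "z \<in> \<Omega>" using mem by simp
    moreover have "t + pi / 2 \<in> {a + pi / 2..b + pi / 2}" using z by simp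
    ultimately show "z \<in> wedge \<Omega> (a + pi / 2) (b + pi / 2)"
      using z(2,4) rot_polar unfolding wedge_def by blast
  next
    fix z assume "z \<in> wedge \<Omega> (a + pi / 2) (b + pi / 2)"
    then obtain r t where z: "z \<in> \<Omega>" "r \<ge> 0" "t \<in> {a + pi / 2..b + pi / 2}"
      "z = (r * cos t, r * sin t)" by (auto simp: wedge_def)
    define s where "s = t - pi / 2"
    have s: "s \<in> {a..b}" "z = rot (r * cos s, r * sin s)"
      using z by (auto simp: s_def rot_polar)
    then have "(r * cos s, r * sin s) \<in> \<Omega>" using z mem by simp
    with s z show "z \<in> rot ` wedge \<Omega> a b" unfolding wedge_def by blast
  qed
qed

lemma negligible_line: "negligible {z :: real \<times> real. fst z * sin a = snd z * cos a}"
proof -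
  have "negligible {z :: real \<times> real. (- sin a, cos a) \<bullet> z = 0}"
    using sin_zero_abs_cos_one[of a] by (intro negligible_hyperplane) (auto simp: zero_prod_def)
  moreover have "{z :: real \<times> real. (- sin a, cos a) \<bullet> z = 0} = {z. fst z * sin a = snd z * cos a}"
    by (auto simp: inner_prod_def algebra_simps)
  ultimately show ?thesis by simp
qed

text \<open>The closed wedges overlap only along boundary rays: the one at b and, when c = a + 2*pi
  completes a full turn, also the one at a. Both lie on lines of measure zero.\<close>

lemma area_wedge_add:
  assumes "compact \<Omega>" "a \<le> b" "b \<le> c" "c \<le> a + 2 * pi"
  shows "area (wedge \<Omega> a c) = area (wedge \<Omega> a b) + area (wedge \<Omega> b c)"
proof -
  have "{a..c} = {a..b} \<union> {b..c}" using assms by auto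
  then have "wedge \<Omega> a c = wedge \<Omega> a b \<union> wedge \<Omega> b c"
    unfolding wedge_def by blast
  moreover have "wedge \<Omega> a b \<inter> wedge \<Omega> b c \<subseteq>
    {z. fst z * sin a = snd z * cos a} \<union> {z. fst z * sin b = snd z * cos b}"
  proof
    fix z assume "z \<in> wedge \<Omega> a b \<inter> wedge \<Omega> b c"
    then obtain r t r' t' where z: "r \<ge> 0" "t \<in> {a..b}" "z = (r * cos t, r * sin t)"
      "r' \<ge> 0" "t' \<in> {b..c}" "z = (r' * cos t', r' * sin t')"
      unfolding wedge_def by blast
    have rr: "r' = r" using norm_polar z by metis
    show "z \<in> {z. fst z * sin a = snd z * cos a} \<union> {z. fst z * sin b = snd z * cos b}"
    proof (cases "r = 0")
      case False
      then obtain k :: int where k: "t' = t + 2 * pi * of_int k"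
        using z rr sin_cos_eq_imp[of t' t] by (metis mult_cancel_left prod.inject)
      have "0 \<le> t' - t" "t' - t \<le> 2 * pi" using z assms by auto
      then have "(2 * pi) * 0 \<le> (2 * pi) * of_int k" "(2 * pi) * of_int k \<le> (2 * pi) * 1"
        using k by simp_all
      then have "0 \<le> real_of_int k" "real_of_int k \<le> 1"
        by (simp_all only: mult_le_cancel_left_pos pi_gt_zero mult_pos_pos zero_less_numeral)
      \<comment> \<open>For k = 0 both angles equal b; for k = 1 necessarily t = a and t' = a +
        2*pi.\<close>
      then have "k = 0 \<or> k = 1" by linarith
      then have "t = b \<or> t = a" using z k assms by auto
      then show ?thesis using z by auto
    qed (use z rr in simp)
  qed
  then have "negligible (wedge \<Omega> a b \<inter> wedge \<Omega> b c)"
    by (rule negligible_subset[rotated]) (intro negligible_Un negligible_line)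
  then have "measure lebesgue (wedge \<Omega> a b \<inter> wedge \<Omega> b c) = 0"
    by (rule negligible_imp_measure0)
  ultimately show ?thesis
    using assms(1) by (simp add: area_def measure_Un3 lmeasurable_compact compact_wedge)
qed

lemma area_wedge_rot:
  assumes "compact \<Omega>" "rot ` \<Omega> = \<Omega>" "0 \<le> \<beta>" "\<beta> \<le> 3 * pi / 2"
  shows "area (wedge \<Omega> 0 (\<beta> + pi / 2)) = area (wedge \<Omega> 0 \<beta>) + area (wedge \<Omega> 0 (pi / 2))"
proof -
  have "area (wedge \<Omega> 0 (\<beta> + pi / 2)) = area (wedge \<Omega> 0 (pi / 2)) + area (wedge \<Omega> (pi / 2) (\<beta> + pi / 2))"
    using assms by (intro area_wedge_add) auto
  moreover have "area (wedge \<Omega> (pi / 2) (\<beta> + pi / 2)) = area (wedge \<Omega> 0 \<beta>)"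
    using rot_wedge[OF assms(2), of 0 \<beta>] area_rot[OF compact_wedge[OF assms(1)], of 0 \<beta>] by simp
  ultimately show ?thesis by simp
qed

lemma area_wedge_quarters:
  assumes "compact \<Omega>" "rot ` \<Omega> = \<Omega>" "0 \<le> \<beta>" "\<beta> + real n * (pi / 2) \<le> 2 * pi"
  shows "area (wedge \<Omega> 0 (\<beta> + real n * (pi / 2))) =
    area (wedge \<Omega> 0 \<beta>) + real n * area (wedge \<Omega> 0 (pi / 2))"
  using assms(4)
proof (induction n)
  case (Suc n)
  have *: "area (wedge \<Omega> 0 (\<beta> + real n * (pi / 2) + pi / 2)) =
      area (wedge \<Omega> 0 (\<beta> + real n * (pi / 2))) + area (wedge \<Omega> 0 (pi / 2))"
    using assms(1-3) Suc.prems by (intro area_wedge_rot) (auto simp: field_simps)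
  have eq: "\<beta> + real n * (pi / 2) + pi / 2 = \<beta> + real (Suc n) * (pi / 2)" by (simp add: algebra_simps)
  have "\<beta> + real n * (pi / 2) \<le> 2 * pi" by (rule order_trans[OF _ Suc.prems]) (simp add: algebra_simps)
  from Suc.IH[OF this] * show ?case unfolding eq by (simp add: algebra_simps)
qed simp

section \<open>The unit ball of the p-norm\<close>

lemma continuous_lp_gauge [continuous_intros]:
  "p > 0 \<Longrightarrow> continuous_on A f \<Longrightarrow> continuous_on A (\<lambda>x. lp_gauge p (f x))"
  unfolding lp_gauge_def by (intro continuous_intros continuous_on_powr') auto

lemma compact_lp_ball:
  assumes "p > 0"
  shows "compact (lp_ball p)"
proof -
  have "lp_ball p \<subseteq> {-1..1} \<times> {-1..1}"
  proof
    fix z assume z: "z \<in> lp_ball p"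
    then have "\<bar>fst z\<bar> powr p \<le> 1" "\<bar>snd z\<bar> powr p \<le> 1"
      using powr_ge_zero[of "\<bar>fst z\<bar>" p] powr_ge_zero[of "\<bar>snd z\<bar>" p]
      unfolding lp_ball_def lp_gauge_def mem_Collect_eq by linarith+
    then show "z \<in> {-1..1} \<times> {-1..1}"
      using assms by (auto simp: powr_le_1_iff mem_Times_iff abs_le_iff)
  qed
  then have "bounded (lp_ball p)"
    by (rule bounded_subset[rotated]) (intro bounded_Times bounded_closed_interval)
  moreover have "closed (lp_ball p)"
    unfolding lp_ball_def using assms by (intro closed_Collect_le continuous_intros)
  ultimately show ?thesis by (simp add: compact_eq_bounded_closed)
qed

lemma frontier_lp_ball:
  assumes "p > 0"
  shows "frontier (lp_ball p) = {z. lp_gauge p z = 1}"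
proof (intro equalityI subsetI)
  fix z assume z: "z \<in> frontier (lp_ball p)"
  have cl: "closed (lp_ball p)" using assms compact_lp_ball compact_imp_closed by blast
  have "open {z. lp_gauge p z < 1}"
    using assms by (intro open_Collect_less continuous_intros)
  then have "{z. lp_gauge p z < 1} \<subseteq> interior (lp_ball p)"
    by (intro interior_maximal) (auto simp: lp_ball_def)
  with z have "\<not> lp_gauge p z < 1" by (auto simp: frontier_def)
  moreover have "lp_gauge p z \<le> 1"
    using z cl by (auto simp: frontier_def lp_ball_def)
  ultimately show "z \<in> {z. lp_gauge p z = 1}" by simp
next
  fix z assume "z \<in> {z. lp_gauge p z = 1}"
  then have z: "lp_gauge p z = 1" by simp
  have "z \<in> closure (- lp_ball p)"
    unfolding closure_sequential
  proof (intro exI conjI allI)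
    show "(1 + inverse (real (Suc n))) *\<^sub>R z \<in> - lp_ball p" for n
    proof -
      define r where "r = 1 + inverse (real (Suc n))"
      have "r > 1" by (simp add: r_def)
      then have "\<not> r powr p \<le> 1" using assms by (simp add: powr_le_1_iff)
      then show ?thesis using \<open>r > 1\<close> z unfolding r_def[symmetric]
        by (simp add: lp_ball_def lp_gauge_scale)
    qed
    have "(\<lambda>n. (1 + inverse (real (Suc n))) *\<^sub>R z) \<longlonglongrightarrow> (1 + 0) *\<^sub>R z"
      by (intro tendsto_intros LIMSEQ_inverse_real_of_nat)
    then show "(\<lambda>n. (1 + inverse (real (Suc n))) *\<^sub>R z) \<longlonglongrightarrow> z" by simp
  qed
  moreover have "z \<in> closure (lp_ball p)" using z by (intro subsetD[OF closure_subset]) (simp add: lp_ball_def)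
  ultimately show "z \<in> frontier (lp_ball p)" by (simp add: frontier_closures)
qed

lemma rot_lp_ball: "rot ` lp_ball p = lp_ball p"
proof (intro equalityI subsetI)
  fix z assume "z \<in> lp_ball p"
  moreover have "z = rot (snd z, - fst z)" by (simp add: rot_def)
  ultimately show "z \<in> rot ` lp_ball p"
    by (intro image_eqI[of _ _ "(snd z, - fst z)"]) (auto simp: lp_ball_def lp_gauge_def add.commute)
qed (auto simp: rot_def lp_ball_def lp_gauge_def add.commute)

lemma lp_point_rot: "lp_point p (\<phi> + pi / 2) = rot (lp_point p \<phi>)"
  by (simp add: lp_point_def rot_def cos_add sin_add)

text \<open>Along a ray the gauge is a multiple of the p-th power of the distance, so it takes the
  value 1 only once and the definite description denotes that point.\<close>

lemma ray_bpoint_lp_ball: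
  assumes "p > 0" "lp_gauge p z = 1" "r > 0" "z = (r * cos \<alpha>, r * sin \<alpha>)"
  shows "ray_bpoint (lp_ball p) \<alpha> = z"
  unfolding ray_bpoint_def
proof (rule the_equality)
  show "z \<in> frontier (lp_ball p) \<and> (\<exists>r>0. z = (r * cos \<alpha>, r * sin \<alpha>))"
    using assms by (auto simp: frontier_lp_ball)
next
  fix w assume w: "w \<in> frontier (lp_ball p) \<and> (\<exists>r>0. w = (r * cos \<alpha>, r * sin \<alpha>))"
  then obtain s where s: "s > 0" "w = (s * cos \<alpha>, s * sin \<alpha>)" by blast
  have "lp_gauge p ((s / r) *\<^sub>R z) = 1" using w s assms by (simp add: frontier_lp_ball)
  then have "(s / r) powr p = 1" using s(1) assms(2,3) by (simp add: lp_gauge_scale)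
  then have "s / r = 1"
    using s assms(1,3) powr_eq_one_iff_gen[of "s / r" p] by (metis divide_pos_pos less_irrefl)
  then show "w = z" using s assms by simp
qed

section \<open>The sector of the first quadrant\<close>

lemma powr_le_iff_le_powr_inverse:
  fixes x c :: real
  assumes "0 \<le> x" "0 \<le> c" "0 < p"
  shows "x powr p \<le> c \<longleftrightarrow> x \<le> c powr (1 / p)"
proof
  assume "x powr p \<le> c"
  then have "(x powr p) powr (1 / p) \<le> c powr (1 / p)" using assms by (intro powr_mono2) auto
  then show "x \<le> c powr (1 / p)" using assms by (simp add: powr_powr)
next
  assume "x \<le> c powr (1 / p)"
  then have "x powr p \<le> (c powr (1 / p)) powr p" using assms by (intro powr_mono2) auto
  then show "x powr p \<le> c" using assms by (simp add: powr_powr)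
qed

text \<open>The first-quadrant arc with x as a function of y. Horizontal slices of a sector are
  single intervals from the ray to this graph, whereas vertical ones would change shape at the
  endpoint of the ray.\<close>

definition lp_graph :: "real \<Rightarrow> real \<Rightarrow> real" where
  "lp_graph p y = (1 - y powr p) powr (1 / p)"

lemma continuous_on_lp_graph:
  assumes "p > 0"
  shows "continuous_on {0..1} (lp_graph p)"
proof -
  have "continuous_on {0..1} (\<lambda>y. (1 - y powr p) powr (1 / p))"
    using assms by (intro continuous_on_powr' continuous_intros) (simp_all add: powr_le_1_iff)
  then show ?thesis by (simp add: lp_graph_def[abs_def])
qed

text \<open>Twice the area of the sector up to parameter \<open>\<psi>\<close>: the region to the left of the graph minus the
  triangle above the ray.\<close>

definition quarter_fun :: "real \<Rightarrow> real \<Rightarrow> real" where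
  "quarter_fun p \<psi> =
    2 * integral {0..sin \<psi> powr (2 / p)} (lp_graph p) - cos \<psi> powr (2 / p) * sin \<psi> powr (2 / p)"

text \<open>The side of the ray is the sign of a cross product, here s * r * sin (t - \<beta>), and
  for angles in [0, pi/2] that is the sign of t - \<beta>. The factor r lets the ray be given by its
  curve point.\<close>

lemma wedge_first_quadrant:
  assumes "0 < r" "0 \<le> \<beta>" "\<beta> \<le> pi / 2"
  shows "wedge (lp_ball p) 0 \<beta> = {(x, y). 0 \<le> x \<and> 0 \<le> y \<and> y * (r * cos \<beta>) \<le> x * (r * sin \<beta>)
    \<and> x powr p + y powr p \<le> 1}"
proof -
  have key: "(s * sin t) * (r * cos \<beta>) \<le> (s * cos t) * (r * sin \<beta>) \<longleftrightarrow> s = 0 \<or> t \<le> \<beta>"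
    if "0 \<le> s" "0 \<le> t" "t \<le> pi / 2" for s t :: real
  proof -
    have "(s * sin t) * (r * cos \<beta>) - (s * cos t) * (r * sin \<beta>) = (s * r) * sin (t - \<beta>)"
      by (simp add: sin_diff algebra_simps)
    moreover have "sin (t - \<beta>) \<le> 0 \<longleftrightarrow> t \<le> \<beta>"
    proof
      assume "t \<le> \<beta>"
      then have "sin (\<beta> - t) \<ge> 0" using assms that by (intro sin_ge_zero) auto
      then show "sin (t - \<beta>) \<le> 0" by (simp add: sin_diff mult.commute)
    next
      assume le: "sin (t - \<beta>) \<le> 0"
      show "t \<le> \<beta>"
      proof (rule ccontr)
        assume "\<not> t \<le> \<beta>"
        then have "sin (t - \<beta>) > 0" using assms that pi_gt_zero by (intro sin_gt_zero) linarith+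
        with le show False by simp
      qed
    qed
    ultimately show ?thesis using assms that
      by (metis diff_ge_0_iff_ge le_iff_diff_le_0 less_eq_real_def mult_eq_0_iff mult_le_0_iff
          mult_pos_pos not_less)
  qed
  show ?thesis
  proof (intro equalityI subsetI)
    fix z assume "z \<in> wedge (lp_ball p) 0 \<beta>"
    then obtain s t where z: "z \<in> lp_ball p" "s \<ge> 0" "t \<in> {0..\<beta>}" "z = (s * cos t, s * sin t)"
      by (auto simp: wedge_def)
    have "cos t \<ge> 0" "sin t \<ge> 0" using z assms by (auto intro!: cos_ge_zero sin_ge_zero)
    then have "0 \<le> s * cos t" "0 \<le> s * sin t" using z by auto
    moreover have "(s * sin t) * (r * cos \<beta>) \<le> (s * cos t) * (r * sin \<beta>)"
      using z assms key[of s t] by simp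
    ultimately show "z \<in> {(x, y). 0 \<le> x \<and> 0 \<le> y \<and> y * (r * cos \<beta>) \<le> x * (r * sin \<beta>) \<and> x powr p + y powr p \<le> 1}"
      using z(1) unfolding z(4) lp_ball_def lp_gauge_def
      by (simp only: mem_Collect_eq prod.case fst_conv snd_conv abs_of_nonneg simp_thms)
  next
    fix z assume "z \<in> {(x, y). 0 \<le> x \<and> 0 \<le> y \<and> y * (r * cos \<beta>) \<le> x * (r * sin \<beta>) \<and> x powr p + y powr p \<le> 1}"
    then obtain x y where z: "z = (x, y)" "0 \<le> x" "0 \<le> y" "y * (r * cos \<beta>) \<le> x * (r * sin \<beta>)"
      "x powr p + y powr p \<le> 1" by auto
    then have ball: "z \<in> lp_ball p" by (simp add: lp_ball_def lp_gauge_def)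
    define s where "s = norm z"
    show "z \<in> wedge (lp_ball p) 0 \<beta>"
    proof (cases "s = 0")
      case True
      then have "z = (0 * cos 0, 0 * sin 0)" by (simp add: s_def zero_prod_def)
      moreover have "(0::real) \<in> {0..\<beta>}" using assms by simp
      ultimately show ?thesis using ball by (auto simp: wedge_def intro!: exI[of _ 0] bexI[of _ 0])
    next
      case False
      have s2: "x\<^sup>2 + y\<^sup>2 = s\<^sup>2" unfolding s_def z(1) norm_Pair by simp
      have "(x / s)\<^sup>2 + (y / s)\<^sup>2 = 1"
        unfolding power_divide add_divide_distrib[symmetric] s2 using False by simp
      moreover have "0 \<le> x / s" "0 \<le> y / s" using z(2,3) by (simp_all add: s_def)
      ultimately obtain t where t: "0 \<le> t" "t \<le> pi / 2" "x / s = cos t" "y / s = sin t"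
        using sincos_total_pi_half by metis
      then have xy: "x = s * cos t" "y = s * sin t" using False by (auto simp: field_simps)
      have "t \<le> \<beta>" using z(4) key[of s t] t False unfolding xy by (simp add: s_def)
      then have "t \<in> {0..\<beta>}" "s \<ge> 0" using t by (auto simp: s_def)
      then show ?thesis using ball xy z(1) unfolding wedge_def by blast
    qed
  qed
qed

text \<open>The same boundary point has polar angle \<beta> and parameter \<psi>; this is where
  angle and parameter meet. Integrating the lengths of horizontal slices gives the area left of the
  graph minus the triangle x0*y0/2.\<close>

lemma area_first_quadrant:
  assumes p: "0 < p" and \<beta>: "0 \<le> \<beta>" "\<beta> \<le> pi / 2" and \<psi>: "0 \<le> \<psi>" "\<psi> \<le> pi / 2"
    and r: "0 < r" "lp_point p \<psi> = (r * cos \<beta>, r * sin \<beta>)"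
  shows "area (wedge (lp_ball p) 0 \<beta>) = quarter_fun p \<psi> / 2"
proof -
  define x0 y0 where "x0 = r * cos \<beta>" and "y0 = r * sin \<beta>"
  let ?T = "wedge (lp_ball p) 0 \<beta>"
  have nn: "0 \<le> cos \<psi>" "0 \<le> sin \<psi>" using \<psi> by (auto intro!: cos_ge_zero sin_ge_zero)
  have x0: "x0 = cos \<psi> powr (2 / p)" and y0: "y0 = sin \<psi> powr (2 / p)"
    using r nn by (auto simp: x0_def y0_def lp_point_def spow_nonneg)
  have nn0: "x0 \<ge> 0" "y0 \<ge> 0" by (simp_all add: x0 y0)
  have curve: "x0 powr p + y0 powr p = 1"
    using lp_gauge_lp_point[OF p, of \<psi>] nn0 unfolding r(2) by (simp add: lp_gauge_def x0_def y0_def)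
  have y0_le: "y0 \<le> 1" proof -
    have "y0 powr p \<le> 1" using curve powr_ge_zero[of x0 p] by linarith
    then show ?thesis using nn0 p by (simp add: powr_le_1_iff)
  qed
  have T: "?T = {(x, y). 0 \<le> x \<and> 0 \<le> y \<and> y * x0 \<le> x * y0 \<and> x powr p + y powr p \<le> 1}"
    unfolding x0_def y0_def by (rule wedge_first_quadrant) (use r \<beta> in auto)
  have comp: "compact ?T" by (intro compact_wedge compact_lp_ball p)
  show ?thesis
  proof (cases "y0 = 0")
    case True
    then have "sin \<beta> = 0" using r by (simp add: y0_def)
    then have "\<beta> = 0" using \<beta> sin_gt_zero[of \<beta>] pi_gt_zero by force
    then have "?T \<subseteq> {z. fst z * sin 0 = snd z * cos 0}" by (auto simp: wedge_def)
    then have "negligible ?T" using negligible_line negligible_subset by blast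
    then have "area ?T = 0" unfolding area_def by (rule negligible_imp_measure0)
    moreover have "quarter_fun p \<psi> = 0" unfolding quarter_fun_def x0[symmetric] y0[symmetric] True by simp
    ultimately show ?thesis by simp
  next
    case False
    then have y0_pos: "y0 > 0" using nn0 by simp
    \<comment> \<open>The ray point at height y is the endpoint scaled by y/y0 \<le> 1, so its gauge
      is at most 1 and it does not lie beyond the arc.\<close>
    have upper: "y * x0 / y0 \<le> lp_graph p y" "y powr p \<le> 1" if "0 \<le> y" "y \<le> y0" for y
    proof -
      have y: "y powr p \<le> 1" using that y0_le p by (simp add: powr_le_1_iff)
      have "(y * x0 / y0) powr p + y powr p = (y / y0) powr p * (x0 powr p + y0 powr p)"
        using that nn0 y0_pos by (simp add: powr_mult powr_divide field_simps)
      also have "\<dots> \<le> 1" unfolding curve using that y0_pos p by (simp add: powr_le_1_iff)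
      finally have "(y * x0 / y0) powr p \<le> 1 - y powr p" by simp
      then show "y * x0 / y0 \<le> lp_graph p y"
        unfolding lp_graph_def using that nn0 y p by (subst (asm) powr_le_iff_le_powr_inverse) auto
      show "y powr p \<le> 1" by fact
    qed
    have slice: "(\<lambda>x. (x, y)) -` ?T = (if y \<in> {0..y0} then {y * x0 / y0..lp_graph p y} else {})" for y
    proof (cases "y \<in> {0..y0}")
      case True
      then have y: "0 \<le> y" "y \<le> y0" "y powr p \<le> 1" using upper by auto
      have "(x, y) \<in> ?T \<longleftrightarrow> x \<in> {y * x0 / y0..lp_graph p y}" for x
      proof -
        have "(x, y) \<in> ?T \<longleftrightarrow> 0 \<le> x \<and> y * x0 / y0 \<le> x \<and> x powr p \<le> 1 - y powr p"
          using y y0_pos by (auto simp: T field_simps)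
        also have "\<dots> \<longleftrightarrow> 0 \<le> x \<and> y * x0 / y0 \<le> x \<and> x \<le> lp_graph p y"
          unfolding lp_graph_def using y p by (auto simp: powr_le_iff_le_powr_inverse)
        also have "\<dots> \<longleftrightarrow> y * x0 / y0 \<le> x \<and> x \<le> lp_graph p y"
          using y nn0 order_trans[of 0 "y * x0 / y0" x] by auto
        finally show ?thesis by simp
      qed
      then show ?thesis using True by auto
    next
      case False
      \<comment> \<open>Above height y0, a point on or to the right of the ray dominates the
        endpoint scaled by y/y0 > 1, whose gauge already exceeds 1.\<close>
      have "(x, y) \<notin> ?T" for x
      proof
        assume "(x, y) \<in> ?T"
        then have xy: "0 \<le> x" "0 \<le> y" "y * x0 \<le> x * y0" "x powr p + y powr p \<le> 1" by (auto simp: T)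
        with False have "y > y0" by simp
        then have "1 < y / y0" using y0_pos by simp
        then have "1 < (y / y0) powr p" using powr_less_mono2[of p 1 "y / y0"] p by simp
        also have "(y / y0) powr p = (y / y0) powr p * (x0 powr p + y0 powr p)" by (simp add: curve)
        also have "\<dots> = (y * x0 / y0) powr p + y powr p"
          using xy nn0 y0_pos by (simp add: powr_mult powr_divide field_simps)
        also have "\<dots> \<le> x powr p + y powr p"
          using xy nn0 y0_pos p by (intro add_mono powr_mono2) (auto simp: field_simps)
        finally show False using xy by simp
      qed
      then show ?thesis using False by auto
    qed
    have cont: "continuous_on {0..y0} (lp_graph p)"
      using continuous_on_subset[OF continuous_on_lp_graph[OF p]] y0_le by auto
    have "((\<lambda>y. y * (x0 / y0)) has_integral ((y0\<^sup>2 - 0\<^sup>2) / 2) * (x0 / y0)) {0..y0}"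
      using nn0 by (intro has_integral_mult_left ident_has_integral)
    then have int: "((\<lambda>y. lp_graph p y - y * (x0 / y0)) has_integral
        integral {0..y0} (lp_graph p) - ((y0\<^sup>2 - 0\<^sup>2) / 2) * (x0 / y0)) {0..y0}"
      by (intro has_integral_diff integrable_integral integrable_continuous_real cont)
    have val: "integral {0..y0} (lp_graph p) - ((y0\<^sup>2 - 0\<^sup>2) / 2) * (x0 / y0) = quarter_fun p \<psi> / 2"
      unfolding quarter_fun_def x0[symmetric] y0[symmetric] using y0_pos
      by (simp add: power2_eq_square)
    have "0 \<le> quarter_fun p \<psi> / 2"
      using has_integral_nonneg[OF int] upper unfolding val by simp
    moreover have "emeasure lborel ?T = ennreal (quarter_fun p \<psi> / 2)"
    proof -
      have "emeasure lborel ?T = (\<integral>\<^sup>+y. emeasure lborel ((\<lambda>x. (x, y)) -` ?T) \<partial>lborel)"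
        using comp by (intro emeasure_lborel_prod borel_compact)
      also have "\<dots> = (\<integral>\<^sup>+y. ennreal (lp_graph p y - y * (x0 / y0)) * indicator {0..y0} y \<partial>lborel)"
        by (intro nn_integral_cong) (use upper in \<open>auto simp: slice indicator_def\<close>)
      also have "\<dots> = ennreal (quarter_fun p \<psi> / 2)"
        using nn_integral_has_integral_lebesgue'[OF _ int] upper unfolding val by simp
      finally show ?thesis .
    qed
    ultimately show ?thesis unfolding area_compact[OF comp] measure_def by simp
  qed
qed

section \<open>Regularity and monotonicity of the quarter-sector function\<close>

lemma continuous_on_quarter_fun:
  assumes "p > 0"
  shows "continuous_on {0..pi / 2} (quarter_fun p)"
proof -
  have H: "continuous_on {0..1} (\<lambda>x. integral {0..x} (lp_graph p))"
    using assms by (intro indefinite_integral_continuous_1 integrable_continuous_real continuous_on_lp_graph)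
  have S: "continuous_on {0..pi / 2} (\<lambda>\<psi>. sin \<psi> powr (2 / p))"
    using assms by (intro continuous_on_powr' continuous_intros) (auto intro!: sin_ge_zero)
  have C: "continuous_on {0..pi / 2} (\<lambda>\<psi>. cos \<psi> powr (2 / p))"
    using assms by (intro continuous_on_powr' continuous_intros) (auto intro!: cos_ge_zero)
  have "(\<lambda>\<psi>. sin \<psi> powr (2 / p)) ` {0..pi / 2} \<subseteq> {0..1}"
    using assms by (auto simp: powr_le_1_iff sin_ge_zero)
  from continuous_on_compose2[OF H S this] show ?thesis
    unfolding quarter_fun_def by (intro continuous_intros S C)
qed

text \<open>The integral contributes 2*x*y' by the fundamental theorem and the triangle -(x*y)';
  cos^2 + sin^2 = 1 then collapses the difference to one term.\<close>

lemma quarter_fun_has_derivative: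
  assumes p: "p > 0" and \<psi>: "0 < \<psi>" "\<psi> < pi / 2"
  shows "(quarter_fun p has_real_derivative (2 / p) * (cos \<psi> * sin \<psi>) powr (2 / p - 1)) (at \<psi>)"
proof -
  have pos: "0 < cos \<psi>" "0 < sin \<psi>" using \<psi> by (auto intro!: cos_gt_zero sin_gt_zero)
  have "sin \<psi> < 1" using sin_monotone_2pi[of \<psi> "pi / 2"] \<psi> by simp
  \<comment> \<open>Lowering the exponent by one gives x = u * cos \<psi> and y = v * sin \<psi>,
    and makes both derivatives multiples of \<open>u\<close> and \<open>v\<close> as well.\<close>
  define u v where "u = cos \<psi> powr (2 / p - 1)" and "v = sin \<psi> powr (2 / p - 1)"
  have C: "cos \<psi> powr (2 / p) = u * cos \<psi>" and S: "sin \<psi> powr (2 / p) = v * sin \<psi>"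
    using pos by (simp_all add: u_def v_def powr_diff)
  have dC: "((\<lambda>\<psi>. cos \<psi> powr (2 / p)) has_real_derivative (2 / p) * u * (- sin \<psi>)) (at \<psi>)"
    unfolding u_def using pos by (auto intro!: derivative_eq_intros simp: powr_diff)
  have dS: "((\<lambda>\<psi>. sin \<psi> powr (2 / p)) has_real_derivative (2 / p) * v * cos \<psi>) (at \<psi>)"
    unfolding v_def using pos by (auto intro!: derivative_eq_intros simp: powr_diff)
  define s where "s = sin \<psi> powr (2 / p)"
  have s: "0 < s" "s < 1"
    using pos \<open>sin \<psi> < 1\<close> p powr_less_mono2[of "2 / p" "sin \<psi>" 1] by (auto simp: s_def)
  have "lp_graph p s = (1 - (sin \<psi>)\<^sup>2) powr (1 / p)"
    using pos p by (simp add: s_def lp_graph_def powr_powr)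
  also have "\<dots> = ((cos \<psi>)\<^sup>2) powr (1 / p)" by (simp add: cos_squared_eq)
  also have "\<dots> = u * cos \<psi>" using pos by (simp add: square_powr C)
  finally have graph: "lp_graph p s = u * cos \<psi>" .
  have "((\<lambda>x. integral {0..x} (lp_graph p)) has_real_derivative lp_graph p s) (at s within {0..1})"
    using s by (intro integral_has_real_derivative continuous_on_lp_graph p) auto
  then have dH: "((\<lambda>x. integral {0..x} (lp_graph p)) has_real_derivative u * cos \<psi>) (at (sin \<psi> powr (2 / p)))"
    using s by (simp add: at_within_Icc_at graph flip: s_def)
  have dHS: "((\<lambda>\<psi>. integral {0..sin \<psi> powr (2 / p)} (lp_graph p)) has_real_derivative
      (u * cos \<psi>) * ((2 / p) * v * cos \<psi>)) (at \<psi>)"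
    by (rule DERIV_chain2[where g = "\<lambda>\<psi>. sin \<psi> powr (2 / p)", OF dH dS])
  have "(quarter_fun p has_real_derivative
      2 * ((u * cos \<psi>) * ((2 / p) * v * cos \<psi>)) -
      (((2 / p) * u * (- sin \<psi>)) * (v * sin \<psi>) + ((2 / p) * v * cos \<psi>) * (u * cos \<psi>))) (at \<psi>)"
    unfolding quarter_fun_def[abs_def]
    using DERIV_diff[OF DERIV_cmult[OF dHS, of 2] DERIV_mult[OF dC dS]] unfolding C S .
  also have "2 * ((u * cos \<psi>) * ((2 / p) * v * cos \<psi>)) -
      (((2 / p) * u * (- sin \<psi>)) * (v * sin \<psi>) + ((2 / p) * v * cos \<psi>) * (u * cos \<psi>)) =
      (2 / p) * (u * v) * ((cos \<psi>)\<^sup>2 + (sin \<psi>)\<^sup>2)"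
    by (simp add: algebra_simps power2_eq_square del: sin_cos_squared_add sin_cos_squared_add2 sin_cos_squared_add3)
  also have "\<dots> = (2 / p) * (cos \<psi> * sin \<psi>) powr (2 / p - 1)"
    using pos by (simp add: u_def v_def powr_mult)
  finally show ?thesis .
qed

lemma quarter_fun_strict_mono:
  assumes "p > 0" "0 \<le> x" "x < y" "y \<le> pi / 2"
  shows "quarter_fun p x < quarter_fun p y"
proof (rule DERIV_pos_imp_increasing_open[OF assms(3)])
  fix t assume t: "x < t" "t < y"
  then have "0 < (2 / p) * (cos t * sin t) powr (2 / p - 1)"
    using assms sin_gt_zero[of t] cos_gt_zero[of t] by simp
  then show "\<exists>d. (quarter_fun p has_real_derivative d) (at t) \<and> 0 < d"
    using quarter_fun_has_derivative[of p t] t assms by auto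
next
  show "continuous_on {x..y} (quarter_fun p)"
    by (rule continuous_on_subset[OF continuous_on_quarter_fun]) (use assms in auto)
qed

lemma quarter_fun_0 [simp]: "quarter_fun p 0 = 0"
  by (simp add: quarter_fun_def)

section \<open>The function \<open>\<Theta>\<^sub>p\<close>\<close>

text \<open>The beta term of \<open>Theta_p\<close> without its sign. For p > 0 it rises on
  [0, pi/4] and falls back to 0 on [pi/4, pi/2].\<close>

definition theta_arc :: "real \<Rightarrow> real \<Rightarrow> real" where
  "theta_arc p \<psi> = (1 / p) * 4 powr (- 1 / p) * inc_beta ((sin (2 * \<psi>))\<^sup>2) (1 / p) (1 / 2)"

lemma Theta_p_alt:
  "Theta_p p \<phi> = (let k = \<lfloor>4 * \<phi> / pi\<rfloor> in
     real_of_int (k - \<lfloor>real_of_int k / 2\<rfloor>) / 2 * Sp p + (-1) powi k * theta_arc p \<phi>)"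
  by (simp add: Theta_p_def theta_arc_def Let_def mult.assoc)

lemma inc_beta_integrable:
  assumes "a > 0" "b > 0"
  shows "(\<lambda>t. t powr (a - 1) * (1 - t) powr (b - 1)) integrable_on {0..1::real}"
  using has_integral_Beta_real[OF assms] by blast

lemma continuous_on_inc_beta:
  assumes "a > 0" "b > 0"
  shows "continuous_on {0..1} (\<lambda>x. inc_beta x a b)"
  unfolding inc_beta_def by (intro indefinite_integral_continuous_1 inc_beta_integrable assms)

lemma inc_beta_has_derivative:
  assumes "a > 0" "b > 0" "0 < x" "x < 1"
  shows "((\<lambda>x. inc_beta x a b) has_real_derivative x powr (a - 1) * (1 - x) powr (b - 1)) (at x)"
proof -
  \<comment> \<open>The integrand may be singular at 0 and 1, so the pointwise fundamental theorem
    is used; the empty set subtracted below is its set of exceptional points.\<close>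
  have "isCont (\<lambda>t. t powr (a - 1) * (1 - t) powr (b - 1)) x"
    using assms by (intro continuous_intros) auto
  then have "continuous (at x within ({0..1} - {})) (\<lambda>t. t powr (a - 1) * (1 - t) powr (b - 1))"
    by (rule continuous_at_imp_continuous_within)
  then have "((\<lambda>x. inc_beta x a b) has_vector_derivative x powr (a - 1) * (1 - x) powr (b - 1))
      (at x within ({0..1} - {}))"
    unfolding inc_beta_def using assms
    by (intro integral_has_vector_derivative_continuous_at inc_beta_integrable) auto
  then show ?thesis
    using assms by (simp add: at_within_Icc_at has_real_derivative_iff_has_vector_derivative)
qed

lemma continuous_on_theta_arc:
  assumes "p > 0"
  shows "continuous_on A (theta_arc p)"
proof -
  have "continuous_on A (\<lambda>\<psi>. inc_beta ((sin (2 * \<psi>))\<^sup>2) (1 / p) (1 / 2))"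
    by (rule continuous_on_compose2[OF continuous_on_inc_beta])
       (use assms in \<open>auto intro!: continuous_intros simp: abs_square_le_1\<close>)
  then show ?thesis unfolding theta_arc_def[abs_def] by (intro continuous_intros)
qed

text \<open>The doubling sin (2*\<psi>) = 2 * sin \<psi> * cos \<psi> produces 2 powr (2/p - 1); the
  normalising factor of \<open>Theta_p\<close> absorbs all of it except 1/2.\<close>

lemma four_powr_mult: "4 powr (- 1 / p) * 2 powr (2 / p - 1) = (1 / 2 :: real)"
proof -
  have "(4::real) = 2 powr 2" by simp
  then have "(4::real) powr (- 1 / p) = 2 powr (- 2 / p)" by (simp only: powr_powr) simp
  then have "4 powr (- 1 / p) * 2 powr (2 / p - 1) = (2::real) powr (- 2 / p + (2 / p - 1))"
    by (simp only: powr_add)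
  also have "\<dots> = 1 / 2" by (simp add: powr_minus_divide)
  finally show ?thesis .
qed

text \<open>With x = sin^2 (2*\<psi>), the factor (1 - x) powr (-1/2) is 1/|cos (2*\<psi>)| and the
  inner derivative supplies cos (2*\<psi>); their product is the sign. At pi/4 the factor is
  singular.\<close>

lemma theta_arc_has_derivative:
  assumes p: "p > 0" and \<psi>: "0 < \<psi>" "\<psi> < pi / 2" "\<psi> \<noteq> pi / 4"
  shows "(theta_arc p has_real_derivative
    sgn (cos (2 * \<psi>)) * ((2 / p) * (cos \<psi> * sin \<psi>) powr (2 / p - 1))) (at \<psi>)"
proof -
  define S C x where "S = sin (2 * \<psi>)" and "C = cos (2 * \<psi>)" and "x = S\<^sup>2"
  have pos: "0 < cos \<psi>" "0 < sin \<psi>" using \<psi> by (auto intro!: cos_gt_zero sin_gt_zero)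
  have S: "S > 0" using \<psi> by (auto simp: S_def intro!: sin_gt_zero)
  have C: "C \<noteq> 0"
  proof (cases "\<psi> < pi / 4")
    case True
    then have "C > 0" using \<psi> unfolding C_def by (intro cos_gt_zero) auto
    then show ?thesis by simp
  next
    case False
    then have "sin (2 * \<psi> - pi / 2) > 0" using \<psi> by (intro sin_gt_zero) auto
    then show ?thesis by (simp add: C_def sin_diff)
  qed
  have C2: "1 - x = C\<^sup>2" by (simp add: x_def S_def C_def cos_squared_eq)
  have x: "0 < x" "x < 1" using S C C2 by (simp_all add: x_def) (metis diff_gt_0_iff_gt zero_less_power2)
  have "((\<lambda>\<psi>. (sin (2 * \<psi>))\<^sup>2) has_real_derivative 4 * S * C) (at \<psi>)"
    by (auto intro!: derivative_eq_intros simp: S_def C_def)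
  note dx = this
  have dB: "((\<lambda>x. inc_beta x (1 / p) (1 / 2)) has_real_derivative
      x powr (1 / p - 1) * (1 - x) powr (1 / 2 - 1)) (at ((sin (2 * \<psi>))\<^sup>2))"
    using inc_beta_has_derivative[of "1 / p" "1 / 2" x] x p by (simp add: x_def S_def)
  have "((\<lambda>\<psi>. inc_beta ((sin (2 * \<psi>))\<^sup>2) (1 / p) (1 / 2)) has_real_derivative
      (x powr (1 / p - 1) * (1 - x) powr (1 / 2 - 1)) * (4 * S * C)) (at \<psi>)"
    by (rule DERIV_chain2[where g = "\<lambda>\<psi>. (sin (2 * \<psi>))\<^sup>2", OF dB dx])
  then have "(theta_arc p has_real_derivative (1 / p * 4 powr (- 1 / p)) *
      ((x powr (1 / p - 1) * (1 - x) powr (1 / 2 - 1)) * (4 * S * C))) (at \<psi>)"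
    unfolding theta_arc_def[abs_def] by (rule DERIV_cmult)
  also have "(1 / p * 4 powr (- 1 / p)) * ((x powr (1 / p - 1) * (1 - x) powr (1 / 2 - 1)) * (4 * S * C)) =
      sgn C * ((2 / p) * (cos \<psi> * sin \<psi>) powr (2 / p - 1))"
  proof -
    have "(1 - x) powr (1 / 2 - 1) = 1 / \<bar>C\<bar>"
      using C unfolding C2 by (simp add: square_powr powr_minus_divide)
    then have 1: "(1 - x) powr (1 / 2 - 1) * C = sgn C" using C by (simp add: sgn_if)
    have "x powr (1 / p - 1) = S powr (2 / p - 2)"
      using S by (simp add: x_def square_powr algebra_simps)
    also have "\<dots> * S = S powr (2 / p - 1)" using S by (simp add: powr_diff field_simps power2_eq_square)
    also have "\<dots> = (2 * (cos \<psi> * sin \<psi>)) powr (2 / p - 1)" 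
      unfolding S_def sin_double by (simp only: mult_ac)
    also have "\<dots> = 2 powr (2 / p - 1) * (cos \<psi> * sin \<psi>) powr (2 / p - 1)"
      using pos by (subst powr_mult) auto
    finally have 2: "x powr (1 / p - 1) * S = 2 powr (2 / p - 1) * (cos \<psi> * sin \<psi>) powr (2 / p - 1)" .
    have 3: "4 powr (- 1 / p) * 2 powr (2 / p - 1) * 4 = (2::real)"
      unfolding four_powr_mult by simp
    have "(1 / p * 4 powr (- 1 / p)) * ((x powr (1 / p - 1) * (1 - x) powr (1 / 2 - 1)) * (4 * S * C)) =
      (1 / p) * 4 * 4 powr (- 1 / p) * (x powr (1 / p - 1) * S) * ((1 - x) powr (1 / 2 - 1) * C)"
      by (simp only: mult_ac)
    also have "\<dots> = (1 / p) * (4 powr (- 1 / p) * 2 powr (2 / p - 1) * 4) *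
        (cos \<psi> * sin \<psi>) powr (2 / p - 1) * sgn C"
      unfolding 1 2 by (simp only: mult_ac)
    finally show ?thesis unfolding 3 by (simp add: mult_ac)
  qed
  finally show ?thesis by (simp add: C_def)
qed

text \<open>Duplication trades the Gamma (z + 1/2) in the denominator for Gamma (2*z) / Gamma z up
  to a power of 2, and its sqrt pi cancels Gamma (1/2). It is applied over the complex numbers and
  transferred back.\<close>

lemma Beta_half:
  assumes "z > (0::real)"
  shows "Beta z (1 / 2) = 2 powr (2 * z - 1) * (Gamma z)\<^sup>2 / Gamma (2 * z)"
proof -
  have nn: "complex_of_real z \<notin> \<int>\<^sub>\<le>\<^sub>0" "complex_of_real z + 1 / 2 \<notin> \<int>\<^sub>\<le>\<^sub>0"
    using assms by (auto elim!: nonpos_Ints_cases simp: complex_eq_iff)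
  have "complex_of_real (Gamma z * Gamma (z + 1 / 2)) =
      complex_of_real (exp ((1 - 2 * z) * ln 2) * sqrt pi * Gamma (2 * z))"
    using Gamma_legendre_duplication[OF nn]
    by (simp add: Gamma_complex_of_real[symmetric] exp_of_real[symmetric])
  then have dup: "Gamma z * Gamma (z + 1 / 2) = 2 powr (1 - 2 * z) * sqrt pi * Gamma (2 * z)"
    unfolding of_real_eq_iff by (simp add: powr_def mult_ac)
  have pos: "Gamma z > 0" "Gamma (z + 1 / 2) > 0" "Gamma (2 * z) > 0"
    using assms by (auto intro!: Gamma_real_pos)
  have inv2: "2 powr (2 * z - 1) * 2 powr (1 - 2 * z) = (1::real)" by (simp flip: powr_add)
  have "(2 powr (2 * z - 1) * (Gamma z)\<^sup>2) * Gamma (z + 1 / 2) =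
      2 powr (2 * z - 1) * Gamma z * (Gamma z * Gamma (z + 1 / 2))"
    by (simp add: power2_eq_square mult_ac)
  also have "\<dots> = (2 powr (2 * z - 1) * 2 powr (1 - 2 * z)) * (Gamma z * sqrt pi * Gamma (2 * z))"
    unfolding dup by (simp only: mult_ac)
  finally show ?thesis
    using pos unfolding inv2 Beta_def Gamma_one_half_real by (simp add: field_simps)
qed

text \<open>At pi/4 the beta integral is complete, and Gamma (1 + x) = x * Gamma x brings it to the
  closed form. The area constant is computed only here.\<close>

lemma theta_arc_pi_4:
  assumes p: "p > 0"
  shows "theta_arc p (pi / 4) = Sp p / 4"
proof -
  have "inc_beta 1 (1 / p) (1 / 2) = Beta (1 / p) (1 / 2)"
    unfolding inc_beta_def using p by (intro integral_unique has_integral_Beta_real) auto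
  also have "\<dots> = 2 powr (2 / p - 1) * (Gamma (1 / p))\<^sup>2 / Gamma (2 / p)"
    using Beta_half[of "1 / p"] p by simp
  finally have B: "inc_beta 1 (1 / p) (1 / 2) = 2 powr (2 / p - 1) * (Gamma (1 / p))\<^sup>2 / Gamma (2 / p)" .
  have "1 / p \<notin> \<int>\<^sub>\<le>\<^sub>0" "2 / p \<notin> \<int>\<^sub>\<le>\<^sub>0"
    using p by (meson divide_pos_pos not_less nonpos_Ints_nonpos zero_less_numeral zero_less_one)+
  then have G: "Gamma (1 + 1 / p) = (1 / p) * Gamma (1 / p)" "Gamma (1 + 2 / p) = (2 / p) * Gamma (2 / p)"
    using p Gamma_plus1[of "1 / p"] Gamma_plus1[of "2 / p"] by (auto simp: add.commute)
  have pos: "Gamma (2 / p) > 0" using p by (intro Gamma_real_pos) simp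
  have "theta_arc p (pi / 4) = (1 / p) * (4 powr (- 1 / p) * 2 powr (2 / p - 1)) * (Gamma (1 / p))\<^sup>2 / Gamma (2 / p)"
    by (simp add: theta_arc_def B)
  also have "\<dots> = Sp p / 4"
    unfolding four_powr_mult Sp_def G using p pos by (simp add: field_simps power2_eq_square)
  finally show ?thesis .
qed

text \<open>On the first half the derivatives agree and both functions vanish at 0. On the second
  half the sign of cos (2*\<psi>) flips, so the sum is constant, and its value at pi/4 is twice
  Sp/4.\<close>

lemma quarter_fun_eq_theta_arc:
  assumes p: "p > 0"
  shows "0 \<le> \<psi> \<Longrightarrow> \<psi> \<le> pi / 4 \<Longrightarrow> quarter_fun p \<psi> = theta_arc p \<psi>"
    and "pi / 4 \<le> \<psi> \<Longrightarrow> \<psi> \<le> pi / 2 \<Longrightarrow> quarter_fun p \<psi> = Sp p / 2 - theta_arc p \<psi>"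
proof -
  have first: "quarter_fun p \<psi> = theta_arc p \<psi>" if \<psi>: "0 \<le> \<psi>" "\<psi> \<le> pi / 4" for \<psi>
  proof -
    have "quarter_fun p \<psi> - theta_arc p \<psi> = quarter_fun p 0 - theta_arc p 0"
    proof (rule DERIV_isconst2[where f = "\<lambda>x. quarter_fun p x - theta_arc p x" and b = "pi / 4"])
      show "continuous_on {0..pi / 4} (\<lambda>x. quarter_fun p x - theta_arc p x)"
        by (intro continuous_on_diff continuous_on_theta_arc p
            continuous_on_subset[OF continuous_on_quarter_fun[OF p]]) auto
      fix x :: real assume x: "0 < x" "x < pi / 4"
      then have "cos (2 * x) > 0" by (intro cos_gt_zero) auto
      then show "((\<lambda>x. quarter_fun p x - theta_arc p x) has_real_derivative 0) (at x)"
        using DERIV_diff[OF quarter_fun_has_derivative[OF p, of x] theta_arc_has_derivative[OF p, of x]] x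
        by simp
    qed (use \<psi> in auto)
    then show ?thesis by (simp add: theta_arc_def inc_beta_def)
  qed
  then show "0 \<le> \<psi> \<Longrightarrow> \<psi> \<le> pi / 4 \<Longrightarrow> quarter_fun p \<psi> = theta_arc p \<psi>" .
  show "quarter_fun p \<psi> = Sp p / 2 - theta_arc p \<psi>" if \<psi>: "pi / 4 \<le> \<psi>" "\<psi> \<le> pi / 2"
  proof -
    have "quarter_fun p \<psi> + theta_arc p \<psi> = quarter_fun p (pi / 4) + theta_arc p (pi / 4)"
    proof (rule DERIV_isconst2[where f = "\<lambda>x. quarter_fun p x + theta_arc p x" and b = "pi / 2"])
      show "continuous_on {pi / 4..pi / 2} (\<lambda>x. quarter_fun p x + theta_arc p x)"
        by (intro continuous_on_add continuous_on_theta_arc p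
            continuous_on_subset[OF continuous_on_quarter_fun[OF p]]) auto
      fix x :: real assume x: "pi / 4 < x" "x < pi / 2"
      then have "sin (2 * x - pi / 2) > 0" by (intro sin_gt_zero) auto
      then have "cos (2 * x) < 0" by (simp add: sin_diff)
      then show "((\<lambda>x. quarter_fun p x + theta_arc p x) has_real_derivative 0) (at x)"
        using DERIV_add[OF quarter_fun_has_derivative[OF p, of x] theta_arc_has_derivative[OF p, of x]] x
        by simp
    qed (use \<psi> in auto)
    then show ?thesis using first[of "pi / 4"] by (simp add: theta_arc_pi_4 p)
  qed
qed

section \<open>Quasi-periodicity and bijectivity of \<open>Theta_p\<close>\<close>

lemma Theta_p_add_pi_half: "Theta_p p (\<phi> + pi / 2) = Theta_p p \<phi> + Sp p / 2"
proof -
  define k where "k = \<lfloor>4 * \<phi> / pi\<rfloor>"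
  \<comment> \<open>A quarter turn raises k by 2: sign and arc stay, and k - floor (k/2) grows by 1,
    which adds Sp/2.\<close>
  have "4 * (\<phi> + pi / 2) / pi = 4 * \<phi> / pi + of_int 2" by (simp add: field_simps)
  then have k: "\<lfloor>4 * (\<phi> + pi / 2) / pi\<rfloor> = k + 2" unfolding k_def by (simp only: floor_add_int)
  have "real_of_int (k + 2) / 2 = real_of_int k / 2 + of_int 1" by simp
  then have k2: "\<lfloor>real_of_int (k + 2) / 2\<rfloor> = \<lfloor>real_of_int k / 2\<rfloor> + 1" by (simp only: floor_add_int)
  have arc: "theta_arc p (\<phi> + pi / 2) = theta_arc p \<phi>"
    by (simp add: theta_arc_def distrib_left)
  have "(-1::real) powi (k + 2) = (-1) powi k" by (simp add: power_int_add)
  then show ?thesis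
    unfolding Theta_p_alt Let_def k k2 arc k_def[symmetric] by (simp add: field_simps)
qed

lemma Theta_p_add_int: "Theta_p p (\<phi> + of_int n * (pi / 2)) = Theta_p p \<phi> + of_int n * (Sp p / 2)"
proof (induction n rule: int_induct[where k = 0])
  case (step1 n)
  then show ?case
    using Theta_p_add_pi_half[of p "\<phi> + of_int n * (pi / 2)"] by (simp add: algebra_simps add_divide_distrib)
next
  case (step2 n)
  then show ?case
    using Theta_p_add_pi_half[of p "\<phi> + of_int (n - 1) * (pi / 2)"]
    by (simp add: algebra_simps add_divide_distrib diff_divide_distrib)
qed simp

lemma Theta_p_eq_quarter_fun:
  assumes p: "p > 0" and \<psi>: "0 \<le> \<psi>" "\<psi> < pi / 2"
  shows "Theta_p p \<psi> = quarter_fun p \<psi>"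
proof (cases "\<psi> < pi / 4")
  case True
  then have "\<lfloor>4 * \<psi> / pi\<rfloor> = 0" using \<psi> by (simp add: floor_eq_iff field_simps)
  then show ?thesis using quarter_fun_eq_theta_arc(1)[OF p, of \<psi>] True \<psi> by (simp add: Theta_p_alt)
next
  case False
  then have "\<lfloor>4 * \<psi> / pi\<rfloor> = 1" using \<psi> by (simp add: floor_eq_iff field_simps)
  moreover have "\<lfloor>1 / 2 :: real\<rfloor> = 0" by (simp add: floor_eq_iff)
  ultimately show ?thesis
    using quarter_fun_eq_theta_arc(2)[OF p, of \<psi>] False \<psi> by (simp add: Theta_p_alt)
qed

text \<open>The beta term vanishes at pi/2, so the quarter area is known without integrating
  \<open>lp_graph\<close> directly.\<close>

lemma quarter_fun_pi_half: "p > 0 \<Longrightarrow> quarter_fun p (pi / 2) = Sp p / 2"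
  using quarter_fun_eq_theta_arc(2)[of p "pi / 2"] by (simp add: theta_arc_def inc_beta_def)

lemma quarter_decomposition:
  obtains n :: int and \<psi> where "0 \<le> \<psi>" "\<psi> < pi / 2" "\<phi> = \<psi> + of_int n * (pi / 2)"
proof -
  define n where "n = \<lfloor>\<phi> / (pi / 2)\<rfloor>"
  have "of_int n \<le> \<phi> / (pi / 2)" "\<phi> / (pi / 2) < of_int n + 1" unfolding n_def by linarith+
  then show ?thesis by (intro that[of "\<phi> - of_int n * (pi / 2)" n]) (simp_all add: field_simps)
qed

lemma Theta_p_quarter:
  assumes "p > 0" "0 \<le> \<psi>" "\<psi> < pi / 2"
  shows "Theta_p p (\<psi> + of_int n * (pi / 2)) = quarter_fun p \<psi> + of_int n * (Sp p / 2)"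
    and "0 \<le> quarter_fun p \<psi>" "quarter_fun p \<psi> < Sp p / 2"
proof -
  show "Theta_p p (\<psi> + of_int n * (pi / 2)) = quarter_fun p \<psi> + of_int n * (Sp p / 2)"
    using assms by (simp only: Theta_p_add_int Theta_p_eq_quarter_fun)
  show "0 \<le> quarter_fun p \<psi>"
    using quarter_fun_strict_mono[of p 0 \<psi>] assms by (cases "\<psi> = 0") auto
  show "quarter_fun p \<psi> < Sp p / 2"
    using quarter_fun_strict_mono[of p \<psi> "pi / 2"] assms by (simp add: quarter_fun_pi_half)
qed

lemma Sp_pos: "p > 0 \<Longrightarrow> Sp p > 0"
  using quarter_fun_strict_mono[of p 0 "pi / 2"] by (simp add: quarter_fun_pi_half)

text \<open>A lexicographic comparison: within a quadrant \<open>quarter_fun\<close> decides, and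
  since its values there stay in [0, Sp/2), a larger quadrant index always wins.\<close>

lemma strict_mono_Theta_p:
  assumes p: "p > 0"
  shows "strict_mono (Theta_p p)"
proof (rule strict_monoI)
  fix x y :: real assume xy: "x < y"
  obtain m \<psi> where x: "0 \<le> \<psi>" "\<psi> < pi / 2" "x = \<psi> + of_int m * (pi / 2)" by (rule quarter_decomposition)
  obtain n \<eta> where y: "0 \<le> \<eta>" "\<eta> < pi / 2" "y = \<eta> + of_int n * (pi / 2)" by (rule quarter_decomposition)
  have "(of_int m - of_int n) * (pi / 2) < 1 * (pi / 2)" using x y xy by (simp add: algebra_simps)
  then have "real_of_int m - of_int n < 1" by (simp only: mult_less_cancel_right_pos pi_half_gt_zero)
  then have "m \<le> n" by linarith
  show "Theta_p p x < Theta_p p y"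
  proof (cases "m = n")
    case True
    then show ?thesis using x y xy p quarter_fun_strict_mono[of p \<psi> \<eta>] by (simp add: Theta_p_quarter del: times_divide_eq_right)
  next
    case False
    with \<open>m \<le> n\<close> have "m + 1 \<le> n" by simp
    then have "real_of_int (m + 1) * (Sp p / 2) \<le> of_int n * (Sp p / 2)"
      using Sp_pos[OF p] by (intro mult_right_mono) auto
    then show ?thesis
      using x y Theta_p_quarter(1)[OF p x(1,2), of m] Theta_p_quarter(1)[OF p y(1,2), of n]
        Theta_p_quarter(3)[OF p x(1,2)] Theta_p_quarter(2)[OF p y(1,2)]
      by (simp add: algebra_simps)
  qed
qed

lemma surj_Theta_p:
  assumes p: "p > 0"
  shows "surj (Theta_p p)"
proof (unfold surj_def, intro allI)
  fix \<theta> :: real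
  define S where "S = Sp p / 2"
  have S: "S > 0" using Sp_pos[OF p] by (simp add: S_def)
  define n where "n = \<lfloor>\<theta> / S\<rfloor>"
  have "of_int n \<le> \<theta> / S" "\<theta> / S < of_int n + 1" unfolding n_def by linarith+
  then have n: "0 \<le> \<theta> - of_int n * S" "\<theta> - of_int n * S < S" using S by (simp_all add: field_simps)
  have "\<exists>\<psi>. 0 \<le> \<psi> \<and> \<psi> \<le> pi / 2 \<and> quarter_fun p \<psi> = \<theta> - of_int n * S"
    using n by (intro IVT') (auto simp: quarter_fun_pi_half p S_def continuous_on_quarter_fun)
  then obtain \<psi> where \<psi>: "0 \<le> \<psi>" "\<psi> \<le> pi / 2" "quarter_fun p \<psi> = \<theta> - of_int n * S" by blast
  then have "\<psi> < pi / 2" using n quarter_fun_pi_half[OF p] by (cases "\<psi> = pi / 2") (auto simp: S_def)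
  then have "Theta_p p (\<psi> + of_int n * (pi / 2)) = \<theta>"
    using Theta_p_quarter(1)[OF p \<psi>(1), of n] \<psi> by (simp add: S_def)
  then show "\<exists>\<phi>. \<theta> = Theta_p p \<phi>" by metis
qed

section \<open>Convex trigonometric functions of the unit ball of the p-norm\<close>

lemma eq_of_eq_mod_2pi:
  fixes k :: int
  assumes "x = y + 2 * pi * of_int k" "0 \<le> x" "x < 2 * pi" "0 \<le> y" "y < 2 * pi"
  shows "x = y"
proof -
  have "2 * pi * of_int k < 2 * pi * 1" "2 * pi * (-1) < 2 * pi * of_int k" using assms by linarith+
  then have "real_of_int k < 1" "-1 < real_of_int k"
    by (simp_all only: mult_less_cancel_left_pos pi_gt_zero mult_pos_pos zero_less_numeral)
  then have "k = 0" by linarith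
  with assms show ?thesis by simp
qed

lemma polar_coordinates:
  fixes z :: "real \<times> real"
  obtains r t where "0 \<le> r" "0 \<le> t" "t < 2 * pi" "z = (r * cos t, r * sin t)"
proof (cases "z = 0")
  case True
  then show ?thesis by (intro that[of 0 0]) (auto simp: zero_prod_def)
next
  case False
  obtain x y where z: "z = (x, y)" by (cases z)
  define r where "r = norm z"
  have r: "r > 0" "x\<^sup>2 + y\<^sup>2 = r\<^sup>2" using False
    by (auto simp: r_def z norm_Pair zero_prod_def sum_power2_gt_zero_iff)
  then have "(x / r)\<^sup>2 + (y / r)\<^sup>2 = 1"
    by (simp add: power_divide flip: add_divide_distrib)
  then obtain t where t: "0 \<le> t" "t < 2 * pi" "x / r = cos t" "y / r = sin t"
    using sincos_total_2pi by metis
  then show ?thesis using r by (intro that[of r t]) (auto simp: z field_simps)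
qed

text \<open>Signed powers and positive scaling preserve the signs of both coordinates, so the
  parameter stays in the quadrant of the ray.\<close>

lemma lp_point_first_quadrant:
  assumes p: "p > 0" and \<beta>: "0 \<le> \<beta>" "\<beta> < pi / 2"
  obtains r \<psi> where "0 < r" "0 \<le> \<psi>" "\<psi> < pi / 2" "lp_point p \<psi> = (r * cos \<beta>, r * sin \<beta>)"
proof -
  have pos: "cos \<beta> > 0" "sin \<beta> \<ge> 0" using \<beta> by (auto intro!: cos_gt_zero_pi sin_ge_zero)
  then have "(cos \<beta>, sin \<beta>) \<noteq> 0" by (auto simp: zero_prod_def)
  then obtain s \<psi> where \<psi>: "s > 0" "0 \<le> \<psi>" "\<psi> < 2 * pi" "(cos \<beta>, sin \<beta>) = s *\<^sub>R lp_point p \<psi>"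
    using polar_decomposition_lp[OF p] by metis
  then have eq: "cos \<beta> = s * spow (2 / p) (cos \<psi>)" "sin \<beta> = s * spow (2 / p) (sin \<psi>)"
    by (simp_all add: lp_point_def)
  have "cos \<psi> > 0" using pos(1) \<psi>(1) unfolding eq
    by (auto simp: spow_def zero_less_mult_iff sgn_if split: if_splits)
  have "sin \<psi> \<ge> 0" using pos(2) \<psi>(1) unfolding eq
    by (auto simp: spow_def zero_le_mult_iff sgn_if split: if_splits)
  then have "\<psi> \<le> pi" using sin_lt_zero[of \<psi>] \<psi> by force
  then have "\<psi> < pi / 2"
    using cos_monotone_0_pi_le[of "pi / 2" \<psi>] \<open>cos \<psi> > 0\<close> by force
  moreover have "lp_point p \<psi> = (1 / s * cos \<beta>, 1 / s * sin \<beta>)"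
    using \<psi>(1) by (simp add: eq lp_point_def)
  ultimately show ?thesis using \<psi> by (intro that[of "1 / s" \<psi>]) auto
qed

lemma lp_point_add_quarters:
  assumes "lp_point p \<psi> = (r * cos \<beta>, r * sin \<beta>)"
  shows "lp_point p (\<psi> + real n * (pi / 2)) =
    (r * cos (\<beta> + real n * (pi / 2)), r * sin (\<beta> + real n * (pi / 2)))"
proof (induction n)
  case (Suc n)
  have e: "x + real (Suc n) * (pi / 2) = (x + real n * (pi / 2)) + pi / 2" for x
    by (simp add: algebra_simps add_divide_distrib)
  show ?case unfolding e lp_point_rot Suc by (simp add: rot_def cos_add sin_add algebra_simps)
qed (use assms in simp)

lemma area_quarter_lp_ball:
  assumes "p > 0"
  shows "area (wedge (lp_ball p) 0 (pi / 2)) = Sp p / 4"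
proof -
  have "lp_point p (pi / 2) = (1 * cos (pi / 2), 1 * sin (pi / 2))"
    by (simp add: lp_point_def spow_def)
  then have "area (wedge (lp_ball p) 0 (pi / 2)) = quarter_fun p (pi / 2) / 2"
    using assms by (intro area_first_quadrant[of p _ _ 1]) auto
  then show ?thesis by (simp add: quarter_fun_pi_half assms)
qed

text \<open>Angle and parameter differ inside a quadrant, but a quarter turn advances both by pi/2,
  so one index n serves for both. The sector consists of n quarters and a rotated first-quadrant
  sector.\<close>

lemma sector_area_lp_ball:
  assumes p: "p > 0" and \<alpha>: "0 \<le> \<alpha>" "\<alpha> < 2 * pi"
  obtains \<phi> r where "0 \<le> \<phi>" "\<phi> < 2 * pi" "0 < r" "lp_point p \<phi> = (r * cos \<alpha>, r * sin \<alpha>)"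
    "area (sector (lp_ball p) \<alpha>) = Theta_p p \<phi> / 2"
proof -
  obtain n' :: int and \<beta> where \<beta>: "0 \<le> \<beta>" "\<beta> < pi / 2" and \<alpha>': "\<alpha> = \<beta> + of_int n' * (pi / 2)"
    by (rule quarter_decomposition)
  have "-1 * (pi / 2) < of_int n' * (pi / 2)" "of_int n' * (pi / 2) < 4 * (pi / 2)"
    using \<alpha> \<alpha>' \<beta> by linarith+
  then have n': "-1 < real_of_int n'" "real_of_int n' < 4"
    by (simp_all only: mult_less_cancel_right_pos pi_half_gt_zero)
  define n where "n = nat n'"
  have n: "real n = of_int n'" "n \<le> 3" using n' by (auto simp: n_def)
  have \<alpha>n: "\<alpha> = \<beta> + real n * (pi / 2)" using \<alpha>' n by simp
  obtain r \<psi> where \<psi>: "0 < r" "0 \<le> \<psi>" "\<psi> < pi / 2" "lp_point p \<psi> = (r * cos \<beta>, r * sin \<beta>)"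
    using lp_point_first_quadrant[OF p \<beta>] by metis
  define \<phi> where "\<phi> = \<psi> + real n * (pi / 2)"
  have "real n * (pi / 2) \<le> 3 * (pi / 2)" using n by (intro mult_right_mono) auto
  moreover have "0 \<le> real n * (pi / 2)" by simp
  ultimately have \<phi>: "0 \<le> \<phi>" "\<phi> < 2 * pi" using \<psi>(2,3) unfolding \<phi>_def by linarith+
  have "area (sector (lp_ball p) \<alpha>) =
      area (wedge (lp_ball p) 0 \<beta>) + real n * area (wedge (lp_ball p) 0 (pi / 2))"
    unfolding sector_eq_wedge \<alpha>n using \<alpha> \<beta> unfolding \<alpha>n
    by (intro area_wedge_quarters compact_lp_ball p rot_lp_ball) auto
  also have "area (wedge (lp_ball p) 0 \<beta>) = quarter_fun p \<psi> / 2"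
    using \<beta> \<psi> p by (intro area_first_quadrant[of p \<beta> \<psi> r]) auto
  also have "quarter_fun p \<psi> / 2 + real n * area (wedge (lp_ball p) 0 (pi / 2)) = Theta_p p \<phi> / 2"
    using Theta_p_quarter(1)[OF p \<psi>(2,3), of "int n"] by (simp add: \<phi>_def area_quarter_lp_ball p)
  finally show ?thesis
    using \<phi> \<psi>(1) lp_point_add_quarters[OF \<psi>(4), of n]
    by (intro that[of \<phi> r]) (simp_all only: \<phi>_def \<alpha>n)
qed

text \<open>Existence: the sector up to \<alpha> is measured by some parameter on that ray, which is
  \<phi> because the ray meets the curve once. Uniqueness: equal areas give equal values of
  \<open>Theta_p\<close>, hence equal parameters, points and angles.\<close>

lemma cvx_angle_lp_ball:
  assumes p: "p > 0" and \<phi>: "0 \<le> \<phi>" "\<phi> < 2 * pi"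
  shows "ray_bpoint (lp_ball p) (cvx_angle (lp_ball p) (Theta_p p \<phi>)) = lp_point p \<phi>"
proof -
  obtain r \<alpha> where \<alpha>: "0 \<le> r" "0 \<le> \<alpha>" "\<alpha> < 2 * pi" "lp_point p \<phi> = (r * cos \<alpha>, r * sin \<alpha>)"
    by (rule polar_coordinates)
  have "r \<noteq> 0" using lp_gauge_lp_point[OF p, of \<phi>] \<alpha>(4) by (auto simp: lp_gauge_def)
  then have r: "r > 0" using \<alpha> by simp
  have bpoint: "ray_bpoint (lp_ball p) \<alpha> = lp_point p \<phi>"
    by (rule ray_bpoint_lp_ball[OF p lp_gauge_lp_point[OF p] r \<alpha>(4)])
  have "cvx_angle (lp_ball p) (Theta_p p \<phi>) = \<alpha>"
    unfolding cvx_angle_def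
  proof (rule the_equality)
    obtain \<phi>' r' where \<phi>': "0 \<le> \<phi>'" "\<phi>' < 2 * pi" "0 < r'" "lp_point p \<phi>' = (r' * cos \<alpha>, r' * sin \<alpha>)"
      "area (sector (lp_ball p) \<alpha>) = Theta_p p \<phi>' / 2"
      using sector_area_lp_ball[OF p \<alpha>(2,3)] by metis
    have "ray_bpoint (lp_ball p) \<alpha> = lp_point p \<phi>'"
      by (rule ray_bpoint_lp_ball[OF p lp_gauge_lp_point[OF p] \<phi>'(3,4)])
    with bpoint have "lp_point p \<phi> = lp_point p \<phi>'" by simp
    then have "\<phi> = \<phi>'"
      using lp_point_eq_imp[OF p] eq_of_eq_mod_2pi \<phi> \<phi>'(1,2) by metis
    with \<phi>' \<alpha> show "\<alpha> \<in> {0..<2 * pi} \<and> area (sector (lp_ball p) \<alpha>) = Theta_p p \<phi> / 2" by simp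
  next
    fix \<alpha>' assume \<alpha>': "\<alpha>' \<in> {0..<2 * pi} \<and> area (sector (lp_ball p) \<alpha>') = Theta_p p \<phi> / 2"
    then obtain \<phi>' r' where \<phi>': "0 < r'" "lp_point p \<phi>' = (r' * cos \<alpha>', r' * sin \<alpha>')"
      "area (sector (lp_ball p) \<alpha>') = Theta_p p \<phi>' / 2"
      using sector_area_lp_ball[OF p, of \<alpha>'] by (metis atLeastLessThan_iff)
    have "Theta_p p \<phi>' = Theta_p p \<phi>" using \<phi>' \<alpha>' by simp
    then have "\<phi>' = \<phi>" using strict_mono_eq[OF strict_mono_Theta_p[OF p]] by simp
    then have eq: "(r' * cos \<alpha>', r' * sin \<alpha>') = (r * cos \<alpha>, r * sin \<alpha>)" using \<phi>' \<alpha> by simp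
    then have "r' = r" using norm_polar[of r' \<alpha>'] norm_polar[of r \<alpha>] \<phi>'(1) r by simp
    with eq r have "cos \<alpha>' = cos \<alpha>" "sin \<alpha>' = sin \<alpha>" by auto
    then obtain k :: int where "\<alpha>' = \<alpha> + 2 * pi * of_int k" by (rule sin_cos_eq_imp)
    from eq_of_eq_mod_2pi[OF this] show "\<alpha>' = \<alpha>" using \<alpha>' \<alpha> by simp
  qed
  with bpoint show ?thesis by simp
qed

lemma area_lp_ball:
  assumes p: "p > 0"
  shows "area (lp_ball p) = Sp p"
proof -
  have "wedge (lp_ball p) 0 (2 * pi) = lp_ball p"
  proof (intro equalityI subsetI)
    fix z assume "z \<in> lp_ball p"
    moreover obtain r t where "0 \<le> r" "0 \<le> t" "t < 2 * pi" "z = (r * cos t, r * sin t)"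
      by (rule polar_coordinates)
    moreover from this have "t \<in> {0..2 * pi}" by simp
    ultimately show "z \<in> wedge (lp_ball p) 0 (2 * pi)" unfolding wedge_def by blast
  qed (auto simp: wedge_def)
  then have "area (lp_ball p) = area (wedge (lp_ball p) 0 (0 + real 4 * (pi / 2)))" by simp
  also have "\<dots> = area (wedge (lp_ball p) 0 0) + real 4 * area (wedge (lp_ball p) 0 (pi / 2))"
    by (intro area_wedge_quarters compact_lp_ball p rot_lp_ball) auto
  also have "area (wedge (lp_ball p) 0 0) = 0"
    using area_first_quadrant[of p 0 0 1] p by (simp add: lp_point_def spow_def)
  finally show ?thesis by (simp add: area_quarter_lp_ball p)
qed

lemma Theta_p_add_2pi: "Theta_p p (\<phi> + 2 * pi * of_int k) = Theta_p p \<phi> + 2 * of_int k * Sp p"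
proof -
  have "2 * pi * of_int k = of_int (4 * k) * (pi / 2)" by simp
  then show ?thesis by (simp only: Theta_p_add_int)
qed

lemma Theta_p_0: "p > 0 \<Longrightarrow> Theta_p p 0 = 0"
  using Theta_p_eq_quarter_fun[of p 0] by simp

text \<open>Reducing the argument modulo twice the area shifts the parameter by full turns, since
  \<open>Theta_p\<close> gains 2 * Sp per turn; monotonicity turns the range [0, 2*Sp) into [0,
  2*pi).\<close>

lemma cvx_point_lp_ball:
  assumes p: "p > 0"
  shows "cvx_point (lp_ball p) (Theta_p p \<phi>) = lp_point p \<phi>"
proof -
  define S where "S = Sp p"
  have S: "S > 0" using Sp_pos[OF p] by (simp add: S_def)
  define m where "m = \<lfloor>Theta_p p \<phi> / (2 * S)\<rfloor>"
  define \<phi>0 where "\<phi>0 = \<phi> + 2 * pi * of_int (- m)"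
  have \<theta>0: "Theta_p p \<phi>0 = Theta_p p \<phi> - 2 * S * of_int m"
    unfolding \<phi>0_def Theta_p_add_2pi by (simp add: S_def)
  have "of_int m \<le> Theta_p p \<phi> / (2 * S)" "Theta_p p \<phi> / (2 * S) < of_int m + 1"
    unfolding m_def by linarith+
  then have "0 \<le> Theta_p p \<phi>0" "Theta_p p \<phi>0 < 2 * S"
    unfolding \<theta>0 using S by (simp_all add: field_simps)
  moreover have "Theta_p p (2 * pi) = 2 * S"
    using Theta_p_add_2pi[of p 0 1] by (simp add: Theta_p_0 p S_def)
  ultimately have "Theta_p p 0 \<le> Theta_p p \<phi>0" "Theta_p p \<phi>0 < Theta_p p (2 * pi)"
    by (simp_all add: Theta_p_0 p)
  then have "0 \<le> \<phi>0" "\<phi>0 < 2 * pi"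
    by (simp_all add: strict_mono_less strict_mono_less_eq strict_mono_Theta_p p)
  then have "ray_bpoint (lp_ball p) (cvx_angle (lp_ball p) (Theta_p p \<phi>0)) = lp_point p \<phi>0"
    by (rule cvx_angle_lp_ball[OF p])
  also have "lp_point p \<phi>0 = lp_point p \<phi>" unfolding \<phi>0_def by (rule lp_point_periodic)
  finally show ?thesis
    unfolding cvx_point_def area_lp_ball[OF p] Let_def \<theta>0 m_def S_def .
qed

section \<open>The inverse function and corresponding angles\<close>

lemma Theta_p_phi_p: "p > 0 \<Longrightarrow> Theta_p p (phi_p p \<theta>) = \<theta>"
  unfolding phi_p_def by (rule surj_f_inv_f[OF surj_Theta_p])

lemma phi_p_Theta_p: "p > 0 \<Longrightarrow> phi_p p (Theta_p p \<phi>) = \<phi>"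
  unfolding phi_p_def by (rule inv_f_f[OF strict_mono_imp_inj_on[OF strict_mono_Theta_p]])

lemma phi_p_eq_iff: "p > 0 \<Longrightarrow> phi_p p \<theta> = \<phi> \<longleftrightarrow> \<theta> = Theta_p p \<phi>"
  using Theta_p_phi_p phi_p_Theta_p by metis

lemma cvx_trig_lp_ball:
  assumes "p > 0"
  shows "cos_cvx (lp_ball p) \<theta> = cos_p p \<theta>" "sin_cvx (lp_ball p) \<theta> = sin_p p \<theta>"
  using cvx_point_lp_ball[OF assms, of "phi_p p \<theta>"] assms
  unfolding Theta_p_phi_p[OF assms]
  by (simp_all add: cos_cvx_def sin_cvx_def cos_p_def sin_p_def lp_point_def spow_def)

lemma cvx_corr_lp_ball:
  assumes "1 < p" "1 < q" "1 / p + 1 / q = 1"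
  shows "cvx_corr (lp_ball p) \<theta> t \<longleftrightarrow>
    (\<exists>k::int. t = Theta_p q (phi_p p \<theta>) + 2 * of_int k * Sp q)"
proof -
  have "cvx_corr (lp_ball p) \<theta> t \<longleftrightarrow> lp_point p (phi_p p \<theta>) \<bullet> lp_point q (phi_p q t) = 1"
    unfolding cvx_corr_def polar_set_lp_ball[OF assms] using assms
    by (simp add: cvx_trig_lp_ball lp_point_def spow_def cos_p_def sin_p_def inner_prod_def)
  also have "\<dots> \<longleftrightarrow> (\<exists>k::int. phi_p q t = phi_p p \<theta> + 2 * pi * of_int k)"
    by (rule lp_point_inner(2)[OF assms])
  also have "\<dots> \<longleftrightarrow> (\<exists>k::int. t = Theta_p q (phi_p p \<theta>) + 2 * of_int k * Sp q)"
    using assms by (simp add: phi_p_eq_iff Theta_p_add_2pi)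
  finally show ?thesis .
qed

theorem theorem2:
  fixes p q :: real and \<Omega> :: "(real \<times> real) set"
  assumes "1 < p" and "p * q = p + q"
    and "\<Omega> = {(u, v). \<bar>u\<bar> powr p + \<bar>v\<bar> powr p \<le> 1}"
  shows "(\<forall>\<theta>. cos_cvx \<Omega> \<theta> = cos_p p \<theta> \<and> sin_cvx \<Omega> \<theta> = sin_p p \<theta>)
    \<and> polar_set \<Omega> = {(u, v). \<bar>u\<bar> powr q + \<bar>v\<bar> powr q \<le> 1}
    \<and> (\<forall>\<theta>. \<exists>\<theta>'.
          phi_p q \<theta>' = phi_p p \<theta>
        \<and> (\<forall>t. phi_p q t = phi_p p \<theta> \<longrightarrow> t = \<theta>')
        \<and> (\<forall>t. cvx_corr \<Omega> \<theta> t \<longleftrightarrow> (\<exists>k::int. t = \<theta>' + 2 * of_int k * Sp q))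
        \<and> cos_cvx (polar_set \<Omega>) \<theta>' = cos_p q \<theta>'
        \<and> sin_cvx (polar_set \<Omega>) \<theta>' = sin_p q \<theta>')
    \<and> area \<Omega> = Sp p"
proof -
  have ball: "{(u, v). \<bar>u\<bar> powr s + \<bar>v\<bar> powr s \<le> 1} = lp_ball s" for s :: real
    by (auto simp: lp_ball_def lp_gauge_def)
  have \<Omega>: "\<Omega> = lp_ball p" unfolding assms(3) by (rule ball)
  have q_eq: "q * (p - 1) = p" using assms(2) by (simp add: algebra_simps)
  have "q * (p - 1) > 1 * (p - 1)" using q_eq by simp
  then have q: "1 < q" using assms(1) mult_less_cancel_right_pos[of "p - 1" 1 q] by linarith
  have conj: "1 / p + 1 / q = 1" using assms(1,2) q by (simp add: field_simps)
  have pos: "p > 0" "q > 0" using assms(1) q by auto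
  show ?thesis
    unfolding \<Omega> polar_set_lp_ball[OF assms(1) q conj] ball
  proof (intro conjI allI)
    fix \<theta>
    show "\<exists>\<theta>'. phi_p q \<theta>' = phi_p p \<theta> \<and> (\<forall>t. phi_p q t = phi_p p \<theta> \<longrightarrow> t = \<theta>')
        \<and> (\<forall>t. cvx_corr (lp_ball p) \<theta> t \<longleftrightarrow> (\<exists>k::int. t = \<theta>' + 2 * of_int k * Sp q))
        \<and> cos_cvx (lp_ball q) \<theta>' = cos_p q \<theta>' \<and> sin_cvx (lp_ball q) \<theta>' = sin_p q \<theta>'"
      \<comment> \<open>The witness keeps the curve parameter of \<theta> and measures it on the
        area scale of the q-ball.\<close>
      by (rule exI[of _ "Theta_p q (phi_p p \<theta>)"])
         (simp add: pos phi_p_eq_iff cvx_trig_lp_ball cvx_corr_lp_ball[OF assms(1) q conj])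
  qed (simp_all add: pos cvx_trig_lp_ball area_lp_ball)
qed

end
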